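(* Consider the online assortment problem with inventory shocks and the Batched Inventory Balancing (BIB) algorithm, both defined in the context. Fix $n$ products with prices $r_i\ge 0$, usage durations $d_i$ and initial inventories $c_i$ ($i\in[n]$), and let $c_0=\min_{i\in[n]}c_i$ be the smallest initial inventory. Let $\Psi:[0,1]\to[0,1]$ be any monotone non-decreasing, concave and differentiable penalty function with $\Psi(0)=0$ and $\Psi(1)=1$, and let $\gamma\in[1,c_0]$ be any integer batch-size threshold. Then the competitive ratio of the BIB algorithm with penalty function $\Psi$ and threshold $\gamma$, against the clairvoyant optimum offline benchmark, is at least $$\Gamma(\Psi,\gamma)=\min\{\Gamma_1(\Psi,\gamma),\Gamma_2(\Psi,\gamma)\},$$ where $$\Gamma_1(\Psi,\gamma)=\min_{x\in[0,1-\frac1{c_0}]}\left\{\frac{1-x}{\frac1{c_0}+\left(1+\frac{\gamma}{c_0}\right)(1-\Psi(x))+\int_{x+\frac1{c_0}}^1\Psi(y)\,dy}\right\},$$ $$\Gamma_2(\Psi,\gamma)=\min_{x\in[0,1-\frac1{\gamma}]}\left\{\frac{1-x}{\frac1{\gamma}+1-\Psi(x)+\int_{x+\frac1{\gamma}}^1\Psi(y)\,dy}\right\}.$$ That is, for every horizon $T\ge1$ and every sequence of consumer choice models and exogenous shocks $\{\phi_t,\xi_{i,t}\}_{i\in[n],t\in[T]}$, the expected revenue of BIB is at least $\Gamma(\Psi,\gamma)$ times the expected revenue of the clairvoyant optimum offline benchmark.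
   Context: **Model.** There are $n$ products, indexed by $[n]=\{1,\dots,n\}$. Product $i$ has initial inventory $c_i\in\mathbb{Z}_{+}$ (positive integer), a deterministic usage duration $d_i$ (positive integer) and per-unit price $r_i\ge 0$. Time is discrete, $t\in[T]$. - Exogenous shocks: at the beginning of period $t$, $\xi_{i,t}\in\mathbb{Z}_{\ge0}$ new units of each product $i$ are added to the inventory (in addition to the initial inventory). - Consumers: consumer $t$ arrives at period $t$ with a choice model $\phi_t:\mathcal{S}\times[n]\to[0,1]$, where $\mathcal{S}\subseteq 2^{[n]}$ is the (nonempty) collection of feasible assortments; $\phi_t(S,i)$ is the probability that consumer $t$ chooses product $i$ when offered $S$ (so $\phi_t(S,i)=0$ for $i\notin S$ and $\sum_i\phi_t(S,i)\le1$; with the remaining probability she chooses nothing). - At period $t$, $\phi_t$ and $\{\xi_{i,t}\}_{i}$ are revealed; the platform, knowing the history, offers an assortment $S_t\in\mathcal{S}$ of products with available inventory. Consumer $t$ randomly (independently given the history) chooses a product $i_t\in S_t$ according to $\phi_t(S_t,\cdot)$, or nothing. If $i_t=i$ is chosen, revenue $r_i$ is collected, and one unit of $i$ leaves the inventory. - Endogenous shocks: a unit of product $i$ sold at period $t$ returns to the inventory at the beginning of period $t+d_i$. **Standing assumptions.** (1) Weak substitutability: $\phi_t(\emptyset,i)=0$, and $\phi_t(S,i)\ge\phi_t(S\cup\{j\},i)$ for all $t$, $i$, $j\neq i$ and $S\in\mathcal{S}$ (whenever $S\cup\{j\}\in\mathcal S$). (2) $\mathcal{S}$ is downward closed: $S\in\mathcal{S}$,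 $S'\subseteq S$ imply $S'\in\mathcal{S}$. (3) There is an exact oracle that, for any $t$ and any $\hat R\in\mathbb{R}_{+}^n$, returns an assortment in $\arg\max_{S\in\mathcal{S}}\sum_{i}\hat R_i\phi_t(S,i)$ having smallest cardinality among all maximizers. **Benchmark and competitive ratio.** The clairvoyant optimum offline benchmark is the maximum expected revenue over all (possibly adaptive) inventory-feasible policies that know the entire sequence $\{\phi_t,\xi_{i,t}\}_{i\in[n],t\in[T]}$ in advance, but not the realizations of the consumers' random choices. Denote it $\mathrm{OPT}[\{\phi_t,\xi_{i,t}\}]$. For fixed products $\{r_i,d_i,c_i\}$, the competitive ratio of an online algorithm $\mathcal A$ is $\inf_{T\ge1}\inf_{\{\phi_t,\xi_{i,t}\}}\mathrm{Rev}_{\mathcal A}[\{\phi_t,\xi_{i,t}\}]/\mathrm{OPT}[\{\phi_t,\xi_{i,t}\}]$, where $\mathrm{Rev}_{\mathcal A}$ is the expected total revenue of $\mathcal A$. **BIB algorithm** (parameters: penalty function $\Psi:[0,1]\to[0,1]$ with $\Psi(0)=0,\Psi(1)=1$, and threshold $\gamma\in\mathbb{N}$). For each product $i$, every unit is permanently assigned to one batch $B_{i,j}$, $j=1,2,\dots$. Initially $B_{i,1}$ consists of the $c_i$ initial units and is "ready", $B_{i,2}=\emptyset$ is "charging", and $h_i=1$ (number of ready batches). In each period $t$: 1. For each $i$, each new unit of product $i$ added by the exogenous shock is put one at a time into the charging batch $B_{i,h_i+1}$; as soon as $|B_{i,h_i+1}|=\gamma$, that batch becomes ready, $h_i$ is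 increased by 1, and a new empty charging batch $B_{i,h_i+1}$ is created. Sold units that return rejoin the batch to which they were originally assigned. 2. For each ready batch $B_{i,j}$ ($j\in[h_i]$), let the normalized inventory level $f_{i,j,t}$ be the fraction of the $|B_{i,j}|$ units of $B_{i,j}$ currently available, i.e. $f_{i,j,t}=1-\frac{1}{|B_{i,j}|}\cdot\#\{t'\in\{t-d_i+1,\dots,t-1\}:\text{ a unit of }B_{i,j}\text{ was sold at }t'\}$. 3. Using the oracle with $\hat R_i=r_i\Psi(\max_{j\in[h_i]}f_{i,j,t})$, compute and offer $S_t\in\arg\max_{S\in\mathcal{S}}\sum_{i\in S}r_i\Psi(\max_{j\in[h_i]}f_{i,j,t})\phi_t(S,i)$. 4. If consumer $t$ chooses product $i^*$, allocate an available unit from batch $B_{i^*,j^*}$ with $j^*\in\arg\max_{j\in[h_{i^*}]}f_{i^*,j,t}$. *)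

theory Defs
  imports "HOL-Probability.Probability"
begin

text \<open>
  Products are the elements of a finite type \<open>'p\<close>; periods are numbered \<open>1, 2, \<dots>\<close>.  A history is
  the list of offered assortments and realised choices, so that the entry with index \<open>k\<close> belongs to
  period \<open>k + 1\<close>, and a history of length \<open>l\<close> is what is known just before the offer of period \<open>l + 1\<close>.
\<close>

type_synonym 'p choice_model = "'p set \<Rightarrow> 'p \<Rightarrow> real"
type_synonym 'p history = "('p set \<times> 'p option) list"
type_synonym 'p policy = "'p history \<Rightarrow> 'p set pmf"

section \<open>Choice models and assortments\<close>

definition downward_closed :: "'p set set \<Rightarrow> bool" where
  "downward_closed F \<longleftrightarrow> (\<forall>S\<in>F. \<forall>S'. S' \<subseteq> S \<longrightarrow> S' \<in> F)"

definition is_choice_model :: "'p::finite set set \<Rightarrow> 'p choice_model \<Rightarrow> bool" where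
  "is_choice_model F \<phi> \<longleftrightarrow>
     (\<forall>S\<in>F. (\<forall>i. 0 \<le> \<phi> S i) \<and> (\<forall>i. i \<notin> S \<longrightarrow> \<phi> S i = 0) \<and> (\<Sum>i\<in>UNIV. \<phi> S i) \<le> 1)"

definition weakly_substitutable :: "'p set set \<Rightarrow> 'p choice_model \<Rightarrow> bool" where
  "weakly_substitutable F \<phi> \<longleftrightarrow>
     (\<forall>i. \<phi> {} i = 0) \<and>
     (\<forall>S\<in>F. \<forall>i j. j \<noteq> i \<and> insert j S \<in> F \<longrightarrow> \<phi> (insert j S) i \<le> \<phi> S i)"

definition admissible :: "'p::finite set set \<Rightarrow> 'p choice_model \<Rightarrow> bool" where
  "admissible F \<phi> \<longleftrightarrow> is_choice_model F \<phi> \<and> weakly_substitutable F \<phi>"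

definition choice_pmf :: "'p::finite choice_model \<Rightarrow> 'p set \<Rightarrow> 'p option pmf" where
  "choice_pmf \<phi> S =
     embed_pmf (\<lambda>x. case x of None \<Rightarrow> 1 - (\<Sum>i\<in>UNIV. \<phi> S i) | Some i \<Rightarrow> \<phi> S i)"

section \<open>Policies, revenue and the offline benchmark\<close>

primrec trajectory ::
  "(nat \<Rightarrow> 'p::finite choice_model) \<Rightarrow> 'p policy \<Rightarrow> nat \<Rightarrow> 'p history pmf" where
  "trajectory \<phi> \<pi> 0 = return_pmf []"
| "trajectory \<phi> \<pi> (Suc t) =
     bind_pmf (trajectory \<phi> \<pi> t) (\<lambda>h.
     bind_pmf (\<pi> h) (\<lambda>S.
     bind_pmf (choice_pmf (\<phi> (Suc t)) S) (\<lambda>x.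
     return_pmf (h @ [(S, x)]))))"

definition expected_revenue ::
  "('p::finite \<Rightarrow> real) \<Rightarrow> (nat \<Rightarrow> 'p choice_model) \<Rightarrow> nat \<Rightarrow> 'p policy \<Rightarrow> real" where
  "expected_revenue r \<phi> T \<pi> =
     measure_pmf.expectation (trajectory \<phi> \<pi> T)
       (\<lambda>h. \<Sum>(S, x)\<leftarrow>h. case x of None \<Rightarrow> 0 | Some i \<Rightarrow> r i)"

text \<open>
  The number of sales with label \<open>y\<close> that have not returned by the beginning of period
  \<open>t = length xs + 1\<close>, where \<open>xs\<close> lists the sales of the periods before \<open>t\<close>: a sale in period
  \<open>t' = k + 1\<close> is outstanding iff \<open>t' < t < t' + dur\<close>.
\<close>

definition outstanding :: "nat \<Rightarrow> 'a \<Rightarrow> 'a list \<Rightarrow> nat" where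
  "outstanding dur y xs = card {k. k < length xs \<and> length xs < k + dur \<and> xs ! k = y}"

definition inventory ::
  "('p \<Rightarrow> nat) \<Rightarrow> ('p \<Rightarrow> nat) \<Rightarrow> ('p \<Rightarrow> nat \<Rightarrow> nat) \<Rightarrow> 'p history \<Rightarrow> 'p \<Rightarrow> int" where
  "inventory c d \<xi> h i =
     int (c i) + (\<Sum>s = 1..Suc (length h). int (\<xi> i s))
       - int (outstanding (d i) (Some i) (map snd h))"

definition feasible_policy ::
  "('p \<Rightarrow> nat) \<Rightarrow> ('p \<Rightarrow> nat) \<Rightarrow> 'p::finite set set \<Rightarrow> (nat \<Rightarrow> 'p choice_model)
     \<Rightarrow> ('p \<Rightarrow> nat \<Rightarrow> nat) \<Rightarrow> nat \<Rightarrow> 'p policy \<Rightarrow> bool" where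
  "feasible_policy c d F \<phi> \<xi> T \<pi> \<longleftrightarrow>
     (\<forall>t<T. \<forall>h\<in>set_pmf (trajectory \<phi> \<pi> t). \<forall>S\<in>set_pmf (\<pi> h).
        S \<in> F \<and> (\<forall>i\<in>S. 0 < inventory c d \<xi> h i))"

text \<open>
  The policy is chosen with knowledge of \<open>\<phi>\<close>, \<open>\<xi>\<close> and \<open>T\<close>, but as a function of the history it sees
  only past choices.
\<close>

definition OPT ::
  "('p \<Rightarrow> nat) \<Rightarrow> ('p \<Rightarrow> nat) \<Rightarrow> ('p \<Rightarrow> real) \<Rightarrow> 'p::finite set set
     \<Rightarrow> (nat \<Rightarrow> 'p choice_model) \<Rightarrow> ('p \<Rightarrow> nat \<Rightarrow> nat) \<Rightarrow> nat \<Rightarrow> real" where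
  "OPT c d r F \<phi> \<xi> T =
     (SUP \<pi>\<in>{\<pi>. feasible_policy c d F \<phi> \<xi> T \<pi>}. expected_revenue r \<phi> T \<pi>)"

text \<open>
  An algorithm is given as the policy that results on each instance.  Instances with zero benchmark,
  on which the ratio is undefined, are left out of the infimum.
\<close>

definition competitive_ratio ::
  "('p \<Rightarrow> nat) \<Rightarrow> ('p \<Rightarrow> nat) \<Rightarrow> ('p \<Rightarrow> real) \<Rightarrow> 'p::finite set set
     \<Rightarrow> ((nat \<Rightarrow> 'p choice_model) \<Rightarrow> ('p \<Rightarrow> nat \<Rightarrow> nat) \<Rightarrow> 'p policy) \<Rightarrow> ereal" where
  "competitive_ratio c d r F alg =
     (INF (T, \<phi>, \<xi>) \<in> {(T, \<phi>, \<xi>). 1 \<le> T \<and> (\<forall>t\<in>{1..T}. admissible F (\<phi> t)) \<and>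
                                   0 < OPT c d r F \<phi> \<xi> T}.
        ereal (expected_revenue r \<phi> T (alg \<phi> \<xi>) / OPT c d r F \<phi> \<xi> T))"

section \<open>Batched inventory balancing\<close>

text \<open>The oracle receives the period, the choice model of that period, and the reduced prices.\<close>

type_synonym 'p oracle_fun = "nat \<Rightarrow> 'p choice_model \<Rightarrow> ('p \<Rightarrow> real) \<Rightarrow> 'p set"

definition exact_oracle :: "'p::finite set set \<Rightarrow> 'p oracle_fun \<Rightarrow> bool" where
  "exact_oracle F orc \<longleftrightarrow>
     (\<forall>t \<phi> R. admissible F \<phi> \<and> (\<forall>i. 0 \<le> R i) \<longrightarrow>
        is_arg_min card
          (is_arg_max (\<lambda>S. \<Sum>i\<in>UNIV. R i * \<phi> S i) (\<lambda>S. S \<in> F))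
          (orc t \<phi> R))"

text \<open>
  The state of a product is the number of ready batches and the number of units in the charging
  batch; it depends only on the exogenous shocks \<open>x t\<close> of that product.
\<close>

definition add_unit :: "nat \<Rightarrow> nat \<times> nat \<Rightarrow> nat \<times> nat" where
  "add_unit \<gamma> = (\<lambda>(h, m). if Suc m = \<gamma> then (Suc h, 0) else (h, Suc m))"

primrec batch_state :: "nat \<Rightarrow> (nat \<Rightarrow> nat) \<Rightarrow> nat \<Rightarrow> nat \<times> nat" where
  "batch_state \<gamma> x 0 = (1, 0)"
| "batch_state \<gamma> x (Suc t) = (add_unit \<gamma> ^^ x (Suc t)) (batch_state \<gamma> x t)"

definition ready :: "nat \<Rightarrow> (nat \<Rightarrow> nat) \<Rightarrow> nat \<Rightarrow> nat set" where
  "ready \<gamma> x t = {1..fst (batch_state \<gamma> x t)}"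

definition batch_size :: "nat \<Rightarrow> ('p \<Rightarrow> nat) \<Rightarrow> 'p \<Rightarrow> nat \<Rightarrow> nat" where
  "batch_size \<gamma> c i j = (if j = 1 then c i else \<gamma>)"

text \<open>A sales log records, period by period, the product sold together with the batch it came from.\<close>

type_synonym 'p sales_log = "('p \<times> nat) option list"

definition level ::
  "nat \<Rightarrow> ('p \<Rightarrow> nat) \<Rightarrow> ('p \<Rightarrow> nat) \<Rightarrow> 'p sales_log \<Rightarrow> 'p \<Rightarrow> nat \<Rightarrow> real" where
  "level \<gamma> c d L i j =
     1 - real (outstanding (d i) (Some (i, j)) L) / real (batch_size \<gamma> c i j)"

definition top_level ::
  "nat \<Rightarrow> ('p \<Rightarrow> nat) \<Rightarrow> ('p \<Rightarrow> nat) \<Rightarrow> ('p \<Rightarrow> nat \<Rightarrow> nat) \<Rightarrow> 'p sales_log \<Rightarrow> 'p \<Rightarrow> real" where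
  "top_level \<gamma> c d \<xi> L i = Max (level \<gamma> c d L i ` ready \<gamma> (\<xi> i) (Suc (length L)))"

definition top_batches ::
  "nat \<Rightarrow> ('p \<Rightarrow> nat) \<Rightarrow> ('p \<Rightarrow> nat) \<Rightarrow> ('p \<Rightarrow> nat \<Rightarrow> nat) \<Rightarrow> 'p sales_log \<Rightarrow> 'p \<Rightarrow> nat set" where
  "top_batches \<gamma> c d \<xi> L i =
     {j \<in> ready \<gamma> (\<xi> i) (Suc (length L)). level \<gamma> c d L i j = top_level \<gamma> c d \<xi> L i}"

definition bib_offer ::
  "(real \<Rightarrow> real) \<Rightarrow> nat \<Rightarrow> 'p oracle_fun \<Rightarrow> ('p \<Rightarrow> nat) \<Rightarrow> ('p \<Rightarrow> nat) \<Rightarrow> ('p \<Rightarrow> real)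
     \<Rightarrow> (nat \<Rightarrow> 'p choice_model) \<Rightarrow> ('p \<Rightarrow> nat \<Rightarrow> nat) \<Rightarrow> 'p sales_log \<Rightarrow> 'p set" where
  "bib_offer \<Psi> \<gamma> orc c d r \<phi> \<xi> L =
     orc (Suc (length L)) (\<phi> (Suc (length L))) (\<lambda>i. r i * \<Psi> (top_level \<gamma> c d \<xi> L i))"

text \<open>The rule that breaks ties among the fullest ready batches of the chosen product.\<close>

type_synonym 'p batch_rule = "'p sales_log \<Rightarrow> 'p \<Rightarrow> nat set \<Rightarrow> nat"

definition valid_batch_rule :: "'p batch_rule \<Rightarrow> bool" where
  "valid_batch_rule sel \<longleftrightarrow> (\<forall>L i J. finite J \<and> J \<noteq> {} \<longrightarrow> sel L i J \<in> J)"

definition bib_log ::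
  "nat \<Rightarrow> 'p batch_rule \<Rightarrow> ('p \<Rightarrow> nat) \<Rightarrow> ('p \<Rightarrow> nat) \<Rightarrow> ('p \<Rightarrow> nat \<Rightarrow> nat)
     \<Rightarrow> 'p history \<Rightarrow> 'p sales_log" where
  "bib_log \<gamma> sel c d \<xi> h =
     foldl (\<lambda>L (S, x). L @ [map_option (\<lambda>i. (i, sel L i (top_batches \<gamma> c d \<xi> L i))) x]) [] h"

definition BIB ::
  "(real \<Rightarrow> real) \<Rightarrow> nat \<Rightarrow> 'p oracle_fun \<Rightarrow> 'p batch_rule \<Rightarrow> ('p \<Rightarrow> nat) \<Rightarrow> ('p \<Rightarrow> nat)
     \<Rightarrow> ('p \<Rightarrow> real) \<Rightarrow> (nat \<Rightarrow> 'p choice_model) \<Rightarrow> ('p \<Rightarrow> nat \<Rightarrow> nat) \<Rightarrow> 'p policy" where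
  "BIB \<Psi> \<gamma> orc sel c d r \<phi> \<xi> h =
     return_pmf (bib_offer \<Psi> \<gamma> orc c d r \<phi> \<xi> (bib_log \<gamma> sel c d \<xi> h))"

section \<open>The guarantee\<close>

text \<open>
  The minima are written as infima; for the penalty functions considered here they are attained,
  since the expressions are continuous in \<open>x\<close> with positive denominators.
\<close>

definition Gamma1 :: "(real \<Rightarrow> real) \<Rightarrow> nat \<Rightarrow> nat \<Rightarrow> real" where
  "Gamma1 \<Psi> c0 \<gamma> =
     (INF x\<in>{0..1 - 1 / real c0}.
        (1 - x) / (1 / real c0 + (1 + real \<gamma> / real c0) * (1 - \<Psi> x)
                   + integral {x + 1 / real c0..1} \<Psi>))"

definition Gamma2 :: "(real \<Rightarrow> real) \<Rightarrow> nat \<Rightarrow> real" where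
  "Gamma2 \<Psi> \<gamma> =
     (INF x\<in>{0..1 - 1 / real \<gamma>}.
        (1 - x) / (1 / real \<gamma> + 1 - \<Psi> x + integral {x + 1 / real \<gamma>..1} \<Psi>))"

definition Gamma_bound :: "(real \<Rightarrow> real) \<Rightarrow> nat \<Rightarrow> nat \<Rightarrow> real" where
  "Gamma_bound \<Psi> c0 \<gamma> = min (Gamma1 \<Psi> c0 \<gamma>) (Gamma2 \<Psi> \<gamma>)"

end

theory Submission
  imports Defs
begin

text \<open>
  Fix a sample path of BIB and let \<open>f i t\<close> be the top level of product \<open>i\<close> on it.  Write
  \<open>r i = r i * \<Psi> (f i t) + r i * (1 - \<Psi> (f i t))\<close>.  The offer of BIB maximises the first part among
  all assortments, so the expected value of the first part under any benchmark policy is at most the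
  sum of these maxima, whose expectation over the path is that of \<open>r i * \<Psi> (f i t)\<close> summed over the
  sales of BIB.  It remains to show, path by path and product by product, that \<open>\<Gamma>\<close> times the sum of
  \<open>\<Psi> (f i t)\<close> over the sales of BIB and of \<open>1 - \<Psi> (f i t)\<close> over the sales of the benchmark is at most
  the number of sales of BIB.

  For this, colour the sales of the benchmark greedily by units, each unit being attached to a ready
  batch.  Sales of one unit are at least \<open>d i\<close> periods apart, so the windows of outstanding sales before
  them are disjoint, and the sales of BIB in a window of a benchmark sale at level \<open>x\<close> pay for it:
  apart from the first, their \<open>\<Psi>\<close>-values are bounded by a lower Riemann sum of the integral in the
  denominators of \<open>\<Gamma>\<close>.
\<close>

section \<open>Windows of outstanding sales\<close>

text \<open>The set behind \<open>outstanding\<close>: unlike a count of list entries, it can be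
  united and intersected with others. Times are list indices, so \<open>t\<close> stands for period
  \<open>t + 1\<close>.\<close>

definition window :: "nat \<Rightarrow> nat set \<Rightarrow> nat \<Rightarrow> nat set" where
  "window d A t = {a \<in> A. a < t \<and> t < a + d}"

lemma finite_window [simp]: "finite (window d A t)"
  by (rule finite_subset[of _ "{..<t}"]) (auto simp: window_def)

lemma window_subset: "window d A t \<subseteq> A"
  by (auto simp: window_def)

text \<open>Everything still out at \<open>t\<close> was sold no later than the last sale
  \<open>s\<close> in the window, and all but \<open>s\<close> itself was already out at
  \<open>s\<close>. So at most one unit is out beyond those out at \<open>s\<close>.\<close>

lemma card_window_le:
  assumes "\<And>s. s \<in> A \<Longrightarrow> card (window d A s) < m"
  shows "card (window d A t) \<le> m"
proof (cases "window d A t = {}")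
  case False
  define s where "s = Max (window d A t)"
  have s: "s \<in> window d A t"
    unfolding s_def using False by (intro Max_in) auto
  have "window d A t \<subseteq> insert s (window d A s)"
  proof
    fix a assume a: "a \<in> window d A t"
    then have "a \<le> s" unfolding s_def by (intro Max_ge) auto
    with a s show "a \<in> insert s (window d A s)"
      by (auto simp: window_def)
  qed
  then have "card (window d A t) \<le> card (insert s (window d A s))"
    by (intro card_mono) auto
  also have "\<dots> \<le> Suc (card (window d A s))"
    by (rule card_insert_le_m1) auto
  also have "\<dots> \<le> m"
    using assms[of s] s by (auto simp: window_def)
  finally show ?thesis .
qed auto

text \<open>Interval colouring in order of time: a new time conflicts only with the times in its own
  window, which use fewer colours than it is offered. The palette \<open>N t\<close> varies with
  \<open>t\<close> because the set of ready batches does.\<close>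

lemma greedy_colouring:
  fixes Y :: "nat set" and N :: "nat \<Rightarrow> 'c set"
  assumes "finite Y" and "\<And>t. t \<in> Y \<Longrightarrow> finite (N t)"
    and "\<And>t. t \<in> Y \<Longrightarrow> card (window d Y t) < card (N t)"
  shows "\<exists>col. (\<forall>t\<in>Y. col t \<in> N t) \<and>
           (\<forall>s\<in>Y. \<forall>t\<in>Y. s < t \<and> t < s + d \<longrightarrow> col s \<noteq> col t)"
  using assms
proof (induction Y rule: finite_linorder_max_induct)
  case empty
  then show ?case by simp
next
  case (insert b A)
  have same: "window d (insert b A) t = window d A t" if "t \<in> insert b A" for t
    using that insert.hyps by (fastforce simp: window_def)
  obtain col where col: "\<forall>t\<in>A. col t \<in> N t"
      "\<forall>s\<in>A. \<forall>t\<in>A. s < t \<and> t < s + d \<longrightarrow> col s \<noteq> col t"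
    using insert.IH insert.prems same by (metis insertCI)
  have "card (col ` window d A b) < card (N b)"
    using card_image_le[of "window d A b" col] insert.prems(2)[of b] same[of b] by simp
  then have "\<not> N b \<subseteq> col ` window d A b"
    using card_mono[of "col ` window d A b" "N b"] by auto
  then obtain y where y: "y \<in> N b" "y \<notin> col ` window d A b" by blast
  have "\<forall>t\<in>insert b A. (col(b := y)) t \<in> N t"
    using col y by auto
  moreover have "\<forall>s\<in>insert b A. \<forall>t\<in>insert b A. s < t \<and> t < s + d \<longrightarrow> (col(b := y)) s \<noteq> (col(b := y)) t"
  proof (intro ballI impI)
    fix s t assume st: "s \<in> insert b A" "t \<in> insert b A" "s < t \<and> t < s + d"
    then have "s \<noteq> b" using insert.hyps by auto
    with st have sA: "s \<in> A" by auto
    show "(col(b := y)) s \<noteq> (col(b := y)) t"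
    proof (cases "t = b")
      case True
      then have "s \<in> window d A b" using sA st by (auto simp: window_def)
      then show ?thesis using y(2) True \<open>s \<noteq> b\<close> by auto
    next
      case False
      then show ?thesis using st sA col(2) \<open>s \<noteq> b\<close> by auto
    qed
  qed
  ultimately show ?case by blast
qed

text \<open>The rank of a sale within a window bounds from below the number of units that were out
  when it was made; each rank occurs once.\<close>

lemma sum_rank:
  fixes W :: "'a::linorder set" and g :: "nat \<Rightarrow> 'b::comm_monoid_add"
  assumes "finite W"
  shows "(\<Sum>s\<in>W. g (card {a \<in> W. a < s})) = (\<Sum>k<card W. g k)"
  using assms
proof (induction W rule: finite_linorder_max_induct)
  case (insert b A)
  have "b \<notin> A" using insert.hyps by auto
  have "{a \<in> insert b A. a < b} = A" using insert.hyps by auto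
  moreover have "{a \<in> insert b A. a < s} = {a \<in> A. a < s}" if "s \<in> A" for s
    using insert.hyps that by force
  ultimately show ?case
    using insert \<open>b \<notin> A\<close> by (simp add: add.commute)
qed auto

text \<open>
  The windows of the times in a \<open>d\<close>-separated set \<open>Y\<close> are disjoint.  A window that holds \<open>a\<close> sales
  pays for its own time: the \<open>k\<close>-th sale in it was made when at least \<open>k - 1\<close> units of the batch were
  out, hence at level at most \<open>1 - (k - 1) / m\<close>.
\<close>

lemma batch_inequality:
  fixes \<Psi> :: "real \<Rightarrow> real" and A Y :: "nat set" and d m :: nat and K G :: real
  defines "f \<equiv> \<lambda>t. 1 - real (card (window d A t)) / real m"
  assumes "finite A" and "finite Y" and "1 \<le> m" and "0 \<le> G" "G \<le> 1"
    and \<Psi>: "\<Psi> ` {0..1} \<subseteq> {0..1}" "\<Psi> 1 = 1" "mono_on {0..1} \<Psi>"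
    and lt: "\<And>s. s \<in> A \<Longrightarrow> card (window d A s) < m"
    and num: "\<And>a. 1 \<le> a \<Longrightarrow> a \<le> m \<Longrightarrow>
       G * (K * (1 - \<Psi> (1 - real a / real m)) + (\<Sum>k<a. \<Psi> (1 - real k / real m))) \<le> real a"
    and sep: "\<And>s t. s \<in> Y \<Longrightarrow> t \<in> Y \<Longrightarrow> s < t \<Longrightarrow> s + d \<le> t"
  shows "G * (K * (\<Sum>t\<in>Y. 1 - \<Psi> (f t)) + (\<Sum>s\<in>A. \<Psi> (f s))) \<le> real (card A)"
proof -
  let ?W = "window d A"
  have le: "card (?W t) \<le> m" for t by (rule card_window_le[OF lt])
  have f01: "f t \<in> {0..1}" for t
    using le[of t] \<open>1 \<le> m\<close> by (auto simp: f_def divide_simps)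
  \<comment> \<open>A sale \<open>a\<close> in both windows would satisfy \<open>a < s\<close> and
    \<open>t < a + d\<close>, against \<open>s + d \<le> t\<close>.\<close>
  have disj: "?W s \<inter> ?W t = {}" if "s \<in> Y" "t \<in> Y" "s < t" for s t
    using sep[OF that] by (auto simp: window_def)
  then have disj': "\<forall>s\<in>Y. \<forall>t\<in>Y. s \<noteq> t \<longrightarrow> ?W s \<inter> ?W t = {}"
    by (metis Int_commute linorder_neq_iff)
  define U where "U = (\<Union>t\<in>Y. ?W t)"
  have "U \<subseteq> A" unfolding U_def using window_subset by fast
  have sum_U: "(\<Sum>s\<in>U. g s) = (\<Sum>t\<in>Y. \<Sum>s\<in>?W t. g s)" for g :: "nat \<Rightarrow> real"
    unfolding U_def by (rule sum.UNION_disjoint) (use \<open>finite Y\<close> disj' in auto)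
  have per: "G * (K * (1 - \<Psi> (f t)) + (\<Sum>s\<in>?W t. \<Psi> (f s))) \<le> (\<Sum>s\<in>?W t. 1)" for t
  proof (cases "?W t = {}")
    case True
    then show ?thesis by (simp add: f_def \<Psi>)
  next
    case False
    let ?a = "card (?W t)"
    have "1 \<le> ?a" using False by (simp add: Suc_le_eq card_gt_0_iff)
    have "(\<Sum>s\<in>?W t. \<Psi> (f s)) \<le> (\<Sum>s\<in>?W t. \<Psi> (1 - real (card {a \<in> ?W t. a < s}) / real m))"
    proof (rule sum_mono)
      fix s assume s: "s \<in> ?W t"
      \<comment> \<open>Sales of the window that precede \<open>s\<close> have not returned by
        \<open>t\<close>, hence not by the earlier time \<open>s\<close>.\<close>
      have "{a \<in> ?W t. a < s} \<subseteq> ?W s" using s by (auto simp: window_def)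
      then have "card {a \<in> ?W t. a < s} \<le> card (?W s)" by (intro card_mono) auto
      moreover from this have "card {a \<in> ?W t. a < s} \<le> m" using le[of s] by linarith
      ultimately show "\<Psi> (f s) \<le> \<Psi> (1 - real (card {a \<in> ?W t. a < s}) / real m)"
        using f01[of s] \<open>1 \<le> m\<close> by (intro mono_onD[OF \<Psi>(3)]) (auto simp: f_def divide_simps)
    qed
    also have "\<dots> = (\<Sum>k<?a. \<Psi> (1 - real k / real m))"
      by (rule sum_rank) simp
    finally have "G * (K * (1 - \<Psi> (f t)) + (\<Sum>s\<in>?W t. \<Psi> (f s)))
        \<le> G * (K * (1 - \<Psi> (1 - real ?a / real m)) + (\<Sum>k<?a. \<Psi> (1 - real k / real m)))"
      unfolding f_def using \<open>0 \<le> G\<close> by (intro mult_left_mono add_left_mono) auto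
    also have "\<dots> \<le> real ?a" by (rule num[OF \<open>1 \<le> ?a\<close> le])
    finally show ?thesis by simp
  qed
  \<comment> \<open>Sales outside every window are matched to no time in \<open>Y\<close>; each
    covers its own \<open>\<Psi>\<close>-value because \<open>G \<le> 1\<close>.\<close>
  have rest: "G * \<Psi> (f s) \<le> 1" for s
  proof -
    have "\<Psi> (f s) \<in> {0..1}" using \<Psi>(1) f01[of s] by blast
    then show ?thesis using \<open>0 \<le> G\<close> \<open>G \<le> 1\<close> by (intro mult_le_one) auto
  qed
  have split: "(\<Sum>s\<in>A. g s) = (\<Sum>s\<in>A - U. g s) + (\<Sum>s\<in>U. g s)" for g :: "nat \<Rightarrow> real"
    using \<open>finite A\<close> \<open>U \<subseteq> A\<close> by (rule sum.subset_diff[rotated])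
  have "G * (K * (\<Sum>t\<in>Y. 1 - \<Psi> (f t)) + (\<Sum>s\<in>A. \<Psi> (f s)))
      = (\<Sum>s\<in>A - U. G * \<Psi> (f s)) + (\<Sum>t\<in>Y. G * (K * (1 - \<Psi> (f t)) + (\<Sum>s\<in>?W t. \<Psi> (f s))))"
    by (simp add: split sum_U sum_distrib_left sum.distrib distrib_left add_ac)
  also have "\<dots> \<le> (\<Sum>s\<in>A - U. 1) + (\<Sum>t\<in>Y. \<Sum>s\<in>?W t. 1)"
    using rest per by (intro add_mono sum_mono) auto
  also have "\<dots> = (\<Sum>s\<in>A. 1)" unfolding split[of "\<lambda>_. 1"] sum_U ..
  finally show ?thesis by simp
qed

text \<open>
  \<open>K j\<close> is the number of benchmark units that are charged to batch \<open>j\<close>; it may exceed the batch size \<open>m j\<close>.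
\<close>

lemma product_inequality:
  fixes \<Psi> :: "real \<Rightarrow> real" and A :: "nat \<Rightarrow> nat set" and d :: nat and m K :: "nat \<Rightarrow> nat"
    and G :: real and top :: "nat \<Rightarrow> real" and h :: "nat \<Rightarrow> nat"
  defines "lev \<equiv> \<lambda>j t. 1 - real (card (window d (A j) t)) / real (m j)"
  assumes fin: "\<And>j. finite (A j)" "finite Y"
    and mK: "\<And>j. 1 \<le> m j" "\<And>j. 1 \<le> K j" and G: "0 \<le> G" "G \<le> 1"
    and \<Psi>: "\<Psi> ` {0..1} \<subseteq> {0..1}" "\<Psi> 1 = 1" "mono_on {0..1} \<Psi>"
    and lt: "\<And>j s. s \<in> A j \<Longrightarrow> card (window d (A j) s) < m j"
    and num: "\<And>j a. 1 \<le> a \<Longrightarrow> a \<le> m j \<Longrightarrow>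
       G * (real (K j) * (1 - \<Psi> (1 - real a / real (m j))) + (\<Sum>k<a. \<Psi> (1 - real k / real (m j)))) \<le> real a"
    and disj: "\<And>i j. i \<noteq> j \<Longrightarrow> A i \<inter> A j = {}"
    and sold: "\<And>j s. s \<in> A j \<Longrightarrow> top s = lev j s"
    and top: "\<And>j t. t \<in> Y \<Longrightarrow> j \<in> {1..h t} \<Longrightarrow> lev j t \<le> top t"
    and top_le: "\<And>t. t \<in> Y \<Longrightarrow> top t \<le> 1"
    and h: "\<And>t. t \<in> Y \<Longrightarrow> h t \<le> H"
    and cap: "\<And>t. t \<in> Y \<Longrightarrow> card (window d Y t) < (\<Sum>j=1..h t. K j)"
  shows "G * ((\<Sum>s\<in>(\<Union>j\<in>{1..H}. A j). \<Psi> (top s)) + (\<Sum>t\<in>Y. 1 - \<Psi> (top t)))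
           \<le> real (card (\<Union>j\<in>{1..H}. A j))"
proof -
  \<comment> \<open>A colour is a pair of a batch and one of the units charged to it; a time
    \<open>t\<close> is offered only the batches ready at \<open>t\<close>.\<close>
  obtain col where col: "\<forall>t\<in>Y. col t \<in> (SIGMA j:{1..h t}. {..<K j})"
      "\<forall>s\<in>Y. \<forall>t\<in>Y. s < t \<and> t < s + d \<longrightarrow> col s \<noteq> col t"
    using greedy_colouring[of Y "\<lambda>t. SIGMA j:{1..h t}. {..<K j}" d] fin cap
    by (auto simp: card_SigmaI)
  define Z where "Z = (\<lambda>j u. {t \<in> Y. col t = (j, u)})"
  have lev01: "lev j t \<in> {0..1}" for j t
    using card_window_le[of "A j" d "m j" t] lt mK(1)[of j] by (auto simp: lev_def divide_simps)
  \<comment> \<open>Charging a time to a batch that is not the fullest only raises its term, since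
    \<open>\<Psi>\<close> is monotone.\<close>
  have "(\<Sum>t\<in>Y. 1 - \<Psi> (top t)) \<le> (\<Sum>t\<in>Y. 1 - \<Psi> (lev (fst (col t)) t))"
  proof (rule sum_mono)
    fix t assume t: "t \<in> Y"
    then have "fst (col t) \<in> {1..h t}" using col(1) by force
    from top[OF t this] have "lev (fst (col t)) t \<le> top t" .
    then show "1 - \<Psi> (top t) \<le> 1 - \<Psi> (lev (fst (col t)) t)"
      using mono_onD[OF \<Psi>(3) lev01[of "fst (col t)" t], of "top t"] top_le[OF t] lev01[of "fst (col t)" t]
      by auto
  qed
  also have "\<dots> = (\<Sum>p\<in>(SIGMA j:{1..H}. {..<K j}). \<Sum>t | t \<in> Y \<and> col t = p. 1 - \<Psi> (lev (fst (col t)) t))"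
    by (rule sum.group[symmetric]) (use fin col(1) h in \<open>force+\<close>)
  also have "\<dots> = (\<Sum>j=1..H. \<Sum>u<K j. \<Sum>t\<in>Z j u. 1 - \<Psi> (lev j t))"
    unfolding Z_def by (subst sum.Sigma) (auto intro!: sum.cong)
  finally have Y: "(\<Sum>t\<in>Y. 1 - \<Psi> (top t)) \<le> (\<Sum>j=1..H. \<Sum>u<K j. \<Sum>t\<in>Z j u. 1 - \<Psi> (lev j t))" .
  have batch: "G * ((\<Sum>s\<in>A j. \<Psi> (top s)) + (\<Sum>u<K j. \<Sum>t\<in>Z j u. 1 - \<Psi> (lev j t))) \<le> real (card (A j))" for j
  proof -
    \<comment> \<open>Each of the \<open>K j\<close> units gives an inequality in which its own
      times carry weight \<open>K j\<close> and the sales of the batch weight one. Adding these and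
      dividing by \<open>K j\<close> leaves every time and every sale with weight one.\<close>
    have "(\<Sum>u<K j. G * (real (K j) * (\<Sum>t\<in>Z j u. 1 - \<Psi> (lev j t)) + (\<Sum>s\<in>A j. \<Psi> (lev j s))))
        \<le> (\<Sum>u<K j. real (card (A j)))"
    proof (rule sum_mono)
      fix u
      have sep: "s + d \<le> t" if "s \<in> Z j u" "t \<in> Z j u" "s < t" for s t
        using that col(2) unfolding Z_def by (metis (mono_tags, lifting) mem_Collect_eq not_le_imp_less)
      show "G * (real (K j) * (\<Sum>t\<in>Z j u. 1 - \<Psi> (lev j t)) + (\<Sum>s\<in>A j. \<Psi> (lev j s))) \<le> real (card (A j))"
        unfolding lev_def
        by (rule batch_inequality) (use fin mK G \<Psi> lt num sep in \<open>auto simp: Z_def\<close>)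
    qed
    then have "real (K j) * (G * ((\<Sum>s\<in>A j. \<Psi> (lev j s)) + (\<Sum>u<K j. \<Sum>t\<in>Z j u. 1 - \<Psi> (lev j t))))
        \<le> real (K j) * real (card (A j))"
      by (simp add: sum.distrib sum_distrib_left algebra_simps)
    moreover have "0 < real (K j)" using mK(2)[of j] by simp
    moreover have "(\<Sum>s\<in>A j. \<Psi> (top s)) = (\<Sum>s\<in>A j. \<Psi> (lev j s))"
      using sold by (intro sum.cong) auto
    ultimately show ?thesis by (metis mult_le_cancel_left_pos)
  qed
  have un: "(\<Sum>s\<in>(\<Union>j\<in>{1..H}. A j). g s) = (\<Sum>j=1..H. \<Sum>s\<in>A j. g s)" for g :: "nat \<Rightarrow> real"
    by (rule sum.UNION_disjoint) (use fin disj in auto)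
  have "G * ((\<Sum>s\<in>(\<Union>j\<in>{1..H}. A j). \<Psi> (top s)) + (\<Sum>t\<in>Y. 1 - \<Psi> (top t)))
      \<le> G * ((\<Sum>j=1..H. \<Sum>s\<in>A j. \<Psi> (top s)) + (\<Sum>j=1..H. \<Sum>u<K j. \<Sum>t\<in>Z j u. 1 - \<Psi> (lev j t)))"
    using Y G unfolding un by (intro mult_left_mono add_mono order_refl) auto
  also have "\<dots> = (\<Sum>j=1..H. G * ((\<Sum>s\<in>A j. \<Psi> (top s)) + (\<Sum>u<K j. \<Sum>t\<in>Z j u. 1 - \<Psi> (lev j t))))"
    by (simp add: sum.distrib sum_distrib_left algebra_simps)
  also have "\<dots> \<le> (\<Sum>j=1..H. real (card (A j)))"
    using batch by (intro sum_mono) auto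
  also have "\<dots> = real (card (\<Union>j\<in>{1..H}. A j))"
    using un[of "\<lambda>_. 1"] by simp
  finally show ?thesis .
qed

section \<open>The constants\<close>

text \<open>The term \<open>k = 0\<close> is \<open>\<Psi> 1 = 1\<close>. Every later term is, by
  monotonicity, at most \<open>m\<close> times the integral of \<open>\<Psi>\<close> over the
  interval of length \<open>1 / m\<close> to its right, and these intervals tile the range of
  integration.\<close>

lemma sum_le_integral:
  fixes \<Psi> :: "real \<Rightarrow> real"
  assumes "mono_on {0..1} \<Psi>" and "continuous_on {0..1} \<Psi>" and "\<Psi> 1 = 1"
    and "1 \<le> a" and "a \<le> m"
  shows "(\<Sum>k<a. \<Psi> (1 - real k / real m))
           \<le> 1 + real m * integral {1 - real a / real m + 1 / real m..1} \<Psi>"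
  using assms(4,5)
proof (induction a rule: dec_induct)
  case base
  then show ?case using assms(3) by simp
next
  case (step a)
  define u where "u = 1 - real a / real m"
  have m: "0 < real m" using step by simp
  have u: "0 \<le> u" "u + 1 / real m \<le> 1"
    using step m by (auto simp: u_def divide_simps)
  have int: "\<Psi> integrable_on {p..q}" if "0 \<le> p" "q \<le> 1" for p q
    by (rule integrable_continuous_real) (use that in \<open>auto intro: continuous_on_subset[OF assms(2)]\<close>)
  have u1: "0 \<le> u + 1 / real m" using u(1) m by (simp add: add_nonneg_nonneg)
  have "\<Psi> u * (1 / real m) = integral {u..u + 1 / real m} (\<lambda>_. \<Psi> u)"
    using m by simp
  also have "\<dots> \<le> integral {u..u + 1 / real m} \<Psi>"
  proof (rule integral_le)
    show "\<Psi> integrable_on {u..u + 1 / real m}" using u by (intro int) auto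
    show "\<Psi> u \<le> \<Psi> x" if "x \<in> {u..u + 1 / real m}" for x
      using that u by (intro mono_onD[OF assms(1)]) auto
  qed auto
  finally have "\<Psi> u \<le> real m * integral {u..u + 1 / real m} \<Psi>"
    using m by (simp add: field_simps)
  moreover have "integral {u..u + 1 / real m} \<Psi> + integral {u + 1 / real m..1} \<Psi> = integral {u..1} \<Psi>"
    using u m by (intro Henstock_Kurzweil_Integration.integral_combine int) auto
  moreover have shift: "1 - real (Suc a) / real m + 1 / real m = u"
    using m by (simp add: u_def field_simps)
  moreover have "(\<Sum>k<a. \<Psi> (1 - real k / real m)) \<le> 1 + real m * integral {u + 1 / real m..1} \<Psi>"
    using step by (simp add: u_def)
  moreover have "(\<Sum>k<Suc a. \<Psi> (1 - real k / real m)) = (\<Sum>k<a. \<Psi> (1 - real k / real m)) + \<Psi> u"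
    by (simp add: u_def)
  moreover have "real m * integral {u..1} \<Psi>
      = real m * integral {u..u + 1 / real m} \<Psi> + real m * integral {u + 1 / real m..1} \<Psi>"
    unfolding calculation(2)[symmetric] by (rule distrib_left)
  ultimately show ?case unfolding shift by linarith
qed

context
  fixes \<Psi> :: "real \<Rightarrow> real"
  assumes range: "\<Psi> ` {0..1} \<subseteq> {0..1}" and one: "\<Psi> 1 = 1" and mono: "mono_on {0..1} \<Psi>"
    and cont: "continuous_on {0..1} \<Psi>"
begin

lemma penalty_range: "0 \<le> x \<Longrightarrow> x \<le> 1 \<Longrightarrow> 0 \<le> \<Psi> x \<and> \<Psi> x \<le> 1"
  using range by force

lemma penalty_integrable: "0 \<le> p \<Longrightarrow> q \<le> 1 \<Longrightarrow> \<Psi> integrable_on {p..q}"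
  by (rule integrable_continuous_real) (auto intro: continuous_on_subset[OF cont])

lemma penalty_integral_nonneg: "0 \<le> p \<Longrightarrow> 0 \<le> integral {p..1} \<Psi>"
  by (rule integral_nonneg[OF penalty_integrable]) (use penalty_range in auto)

lemma penalty_integral_le:
  assumes "0 \<le> p" "p \<le> q" "q \<le> 1"
  shows "integral {p..q} \<Psi> \<le> q - p"
proof -
  have "integral {p..q} \<Psi> \<le> integral {p..q} (\<lambda>_. 1)"
    by (rule integral_le[OF penalty_integrable]) (use assms penalty_range in auto)
  then show ?thesis using assms by simp
qed

text \<open>The weight \<open>q\<close> covers both denominators: \<open>1 + \<gamma> / c0\<close>
  in \<open>Gamma1\<close> and \<open>1\<close> in \<open>Gamma2\<close>. Nonnegativity of the
  ratios also supplies the lower bound that the infima require.\<close>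

lemma ratio_nonneg:
  assumes "x \<in> {0..1 - 1 / real m}" "1 \<le> m" "0 \<le> q"
  shows "0 < 1 / real m + q * (1 - \<Psi> x) + integral {x + 1 / real m..1} \<Psi>"
    and "0 \<le> (1 - x) / (1 / real m + q * (1 - \<Psi> x) + integral {x + 1 / real m..1} \<Psi>)"
proof -
  have "0 < 1 / real m" using assms by simp
  moreover have "0 \<le> x" "x \<le> 1 - 1 / real m" using assms(1) by auto
  ultimately have x: "0 \<le> x" "x \<le> 1" by linarith+
  show *: "0 < 1 / real m + q * (1 - \<Psi> x) + integral {x + 1 / real m..1} \<Psi>"
    using penalty_range[OF x] x assms(3) \<open>0 < 1 / real m\<close>
    by (intro add_pos_nonneg penalty_integral_nonneg mult_nonneg_nonneg) auto
  then show "0 \<le> (1 - x) / (1 / real m + q * (1 - \<Psi> x) + integral {x + 1 / real m..1} \<Psi>)"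
    using x by simp
qed

lemma Gamma1_mult_le:
  assumes "x \<in> {0..1 - 1 / real c0}" "1 \<le> c0"
  shows "Gamma1 \<Psi> c0 \<gamma> * (1 / real c0 + (1 + real \<gamma> / real c0) * (1 - \<Psi> x)
            + integral {x + 1 / real c0..1} \<Psi>) \<le> 1 - x"
proof -
  have "Gamma1 \<Psi> c0 \<gamma> \<le> (1 - x) / (1 / real c0 + (1 + real \<gamma> / real c0) * (1 - \<Psi> x)
            + integral {x + 1 / real c0..1} \<Psi>)"
    unfolding Gamma1_def
    by (rule cINF_lower[OF _ assms(1)], rule bdd_belowI2[where m = 0], rule ratio_nonneg)
       (use assms(2) in auto)
  then show ?thesis
    using ratio_nonneg(1)[OF assms, of "1 + real \<gamma> / real c0"] by (simp add: pos_le_divide_eq)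
qed

lemma Gamma2_mult_le:
  assumes "x \<in> {0..1 - 1 / real \<gamma>}" "1 \<le> \<gamma>"
  shows "Gamma2 \<Psi> \<gamma> * (1 / real \<gamma> + (1 - \<Psi> x) + integral {x + 1 / real \<gamma>..1} \<Psi>) \<le> 1 - x"
proof -
  have "Gamma2 \<Psi> \<gamma> \<le> (1 - x) / (1 / real \<gamma> + 1 * (1 - \<Psi> x) + integral {x + 1 / real \<gamma>..1} \<Psi>)"
    unfolding Gamma2_def add_diff_eq[symmetric] mult_1
    by (rule cINF_lower[OF _ assms(1)], rule bdd_belowI2[where m = 0])
       (use ratio_nonneg(2)[of _ \<gamma> 1] assms(2) in simp)
  then show ?thesis
    using ratio_nonneg(1)[OF assms, of 1] by (simp add: pos_le_divide_eq)
qed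

lemma Gamma_bound_nonneg:
  assumes "1 \<le> c0" "1 \<le> \<gamma>"
  shows "0 \<le> Gamma_bound \<Psi> c0 \<gamma>"
proof -
  have "0 \<le> Gamma1 \<Psi> c0 \<gamma>"
    unfolding Gamma1_def
    by (rule cINF_greatest) (use assms ratio_nonneg(2)[of _ c0 "1 + real \<gamma> / real c0"] in auto)
  moreover have "0 \<le> Gamma2 \<Psi> \<gamma>"
    unfolding Gamma2_def add_diff_eq[symmetric]
    by (rule cINF_greatest) (use assms ratio_nonneg(2)[of _ \<gamma> 1] in auto)
  ultimately show ?thesis by (simp add: Gamma_bound_def)
qed

text \<open>At the right end \<open>x = 1 - 1 / \<gamma>\<close> the integral in
  \<open>Gamma2\<close> vanishes and the ratio is at most one, since
  \<open>\<Psi> \<le> 1\<close>.\<close>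

lemma Gamma_bound_le_one:
  assumes "1 \<le> c0" "1 \<le> \<gamma>"
  shows "Gamma_bound \<Psi> c0 \<gamma> \<le> 1"
proof -
  have "Gamma_bound \<Psi> c0 \<gamma> * (1 / real \<gamma>)
      \<le> Gamma2 \<Psi> \<gamma> * (1 / real \<gamma> + (1 - \<Psi> (1 - 1 / real \<gamma>)))"
    using penalty_range[of "1 - 1 / real \<gamma>"] assms Gamma_bound_nonneg[OF assms]
    by (intro mult_mono) (auto simp: Gamma_bound_def)
  also have "\<dots> \<le> 1 / real \<gamma>"
    using Gamma2_mult_le[of "1 - 1 / real \<gamma>" \<gamma>] assms by simp
  finally show ?thesis using assms by (simp add: divide_le_cancel)
qed

section \<open>Numerical conditions for initial and later batches\<close>

text \<open>With \<open>x = 1 - a / m\<close> and after division by \<open>m\<close>, the condition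
  asked of a batch takes the shape of the denominators of the constants. The weight on
  \<open>1 - \<Psi> x\<close> is \<open>K / m\<close>, the number of charged units per unit of the
  batch.\<close>

lemma batch_condition:
  assumes "0 \<le> G" and "1 \<le> a" "a \<le> m"
    and "G * (1 / real m + K / real m * (1 - \<Psi> (1 - real a / real m))
            + integral {1 - real a / real m + 1 / real m..1} \<Psi>) \<le> real a / real m"
  shows "G * (K * (1 - \<Psi> (1 - real a / real m)) + (\<Sum>k<a. \<Psi> (1 - real k / real m))) \<le> real a"
proof -
  let ?x = "1 - real a / real m"
  have m: "0 < real m" using assms by simp
  have "G * (K * (1 - \<Psi> ?x) + (\<Sum>k<a. \<Psi> (1 - real k / real m)))
      \<le> G * (K * (1 - \<Psi> ?x) + (1 + real m * integral {?x + 1 / real m..1} \<Psi>))"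
    by (intro mult_left_mono add_left_mono sum_le_integral mono cont one assms)
  also have "\<dots> = real m * (G * (1 / real m + K / real m * (1 - \<Psi> ?x) + integral {?x + 1 / real m..1} \<Psi>))"
    using m by (simp add: field_simps)
  also have "\<dots> \<le> real m * (real a / real m)"
    using assms(4) m by (intro mult_left_mono) auto
  finally show ?thesis using m by simp
qed

lemma later_batch_condition:
  assumes "1 \<le> c0" "1 \<le> a" "a \<le> \<gamma>"
  shows "Gamma_bound \<Psi> c0 \<gamma> * (real \<gamma> * (1 - \<Psi> (1 - real a / real \<gamma>))
           + (\<Sum>k<a. \<Psi> (1 - real k / real \<gamma>))) \<le> real a"
proof (rule batch_condition[OF Gamma_bound_nonneg])
  have x: "1 - real a / real \<gamma> \<in> {0..1 - 1 / real \<gamma>}"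
    using assms by (auto simp: divide_simps)
  have "Gamma_bound \<Psi> c0 \<gamma> * (1 / real \<gamma> + 1 * (1 - \<Psi> (1 - real a / real \<gamma>))
            + integral {1 - real a / real \<gamma> + 1 / real \<gamma>..1} \<Psi>)
      \<le> Gamma2 \<Psi> \<gamma> * (1 / real \<gamma> + 1 * (1 - \<Psi> (1 - real a / real \<gamma>))
            + integral {1 - real a / real \<gamma> + 1 / real \<gamma>..1} \<Psi>)"
    using ratio_nonneg(1)[OF x, of 1] assms
    by (intro mult_right_mono) (auto simp: Gamma_bound_def)
  also have "\<dots> \<le> real a / real \<gamma>"
    using Gamma2_mult_le[OF x] assms by simp
  finally show "Gamma_bound \<Psi> c0 \<gamma> * (1 / real \<gamma> + real \<gamma> / real \<gamma> * (1 - \<Psi> (1 - real a / real \<gamma>))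
            + integral {1 - real a / real \<gamma> + 1 / real \<gamma>..1} \<Psi>) \<le> real a / real \<gamma>"
    using assms by simp
qed (use assms in auto)

text \<open>
  For \<open>x \<le> 1 - 1 / c0\<close> the denominator decreases in the stock.  Beyond that range \<open>Gamma1\<close> says nothing
  about \<open>x\<close>, and concavity reduces the claim to the endpoint \<open>z = 1 - 1 / c0\<close>, as the slope
  \<open>(1 - \<Psi> x) / (1 - x)\<close> decreases in \<open>x\<close>.
\<close>

lemma Gamma1_larger_stock:
  assumes "concave_on {0..1} \<Psi>" and "1 \<le> c0" "c0 \<le> m" and x: "0 \<le> x" "x \<le> 1 - 1 / real m"
    and G: "0 \<le> G" "G \<le> Gamma1 \<Psi> c0 \<gamma>"
  shows "G * (1 / real m + (1 + real \<gamma> / real m) * (1 - \<Psi> x) + integral {x + 1 / real m..1} \<Psi>) \<le> 1 - x"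
proof -
  let ?q = "1 + real \<gamma> / real c0"
  have pos: "0 < real c0" "0 < real m" using assms by auto
  have inv: "1 / real m \<le> 1 / real c0" using assms by (simp add: frac_le)
  have q: "1 + real \<gamma> / real m \<le> ?q"
    using assms by (simp add: frac_le)
  have x1: "x \<le> 1" "x < 1" "x + 1 / real m \<le> 1" using x pos by (smt (verit) divide_pos_pos)+
  have im: "0 < 1 / real m" using pos by simp
  have \<Psi>x: "0 \<le> 1 - \<Psi> x" using penalty_range x(1) x1(1) by simp
  note step = mult_right_mono[OF q \<Psi>x]
  show ?thesis
  proof (cases "x \<le> 1 - 1 / real c0")
    case True
    \<comment> \<open>Passing from \<open>m\<close> to \<open>c0\<close> shortens the integral by at
      most the increase of the first summand, as \<open>\<Psi> \<le> 1\<close>.\<close>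
    have "integral {x + 1 / real m..x + 1 / real c0} \<Psi> \<le> 1 / real c0 - 1 / real m"
      using penalty_integral_le[of "x + 1 / real m" "x + 1 / real c0"] inv True x im by simp
    moreover have "integral {x + 1 / real m..x + 1 / real c0} \<Psi> + integral {x + 1 / real c0..1} \<Psi>
        = integral {x + 1 / real m..1} \<Psi>"
      using x inv True im by (intro Henstock_Kurzweil_Integration.integral_combine penalty_integrable) auto
    ultimately have "1 / real m + (1 + real \<gamma> / real m) * (1 - \<Psi> x) + integral {x + 1 / real m..1} \<Psi>
        \<le> 1 / real c0 + ?q * (1 - \<Psi> x) + integral {x + 1 / real c0..1} \<Psi>" (is "?l \<le> ?r")
      using step by linarith
    then have "G * ?l \<le> G * ?r" using G by (intro mult_left_mono)
    also have "\<dots> \<le> Gamma1 \<Psi> c0 \<gamma> * ?r"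
      using ratio_nonneg(1)[of x c0 ?q] True x assms by (intro mult_right_mono) auto
    also have "\<dots> \<le> 1 - x" using Gamma1_mult_le True x assms by auto
    finally show ?thesis .
  next
    case False
    define z where "z = 1 - 1 / real c0"
    have z: "0 \<le> z" "z < x" "z < 1" "1 - z = 1 / real c0"
      using False assms by (auto simp: z_def divide_simps)
    have \<Psi>z: "0 \<le> 1 - \<Psi> z" using penalty_range z by simp
    have slope: "(1 - \<Psi> x) * (1 - z) \<le> (1 - \<Psi> z) * (1 - x)"
    proof -
      \<comment> \<open>The weight for which \<open>x\<close> is the convex combination
        \<open>v * z + (1 - v) * 1\<close>.\<close>
      define v where "v = (1 - x) / (1 - z)"
      have v: "0 \<le> v" "v \<le> 1" "v * (1 - z) = 1 - x" using z(1-3) x1 by (auto simp: v_def)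
      have "(1 - (1 - v)) * \<Psi> z + (1 - v) * \<Psi> 1 \<le> \<Psi> ((1 - (1 - v)) *\<^sub>R z + (1 - v) *\<^sub>R 1)"
        using concave_onD[OF assms(1), of "1 - v" z 1] v z by auto
      moreover have "v * z + (1 - v) = x" using v(3) by (simp add: algebra_simps)
      ultimately have "1 - \<Psi> x \<le> v * (1 - \<Psi> z)" using one by (simp add: algebra_simps)
      then have "(1 - \<Psi> x) * (1 - z) \<le> v * (1 - \<Psi> z) * (1 - z)"
        using z by (intro mult_right_mono) auto
      also have "\<dots> = (v * (1 - z)) * (1 - \<Psi> z)" by simp
      finally show ?thesis using v(3) by (simp add: mult.commute)
    qed
    have "integral {x + 1 / real m..1} \<Psi> \<le> 1 - x - 1 / real m"
      using penalty_integral_le[of "x + 1 / real m" 1] x x1 im by simp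
    with step have "1 / real m + (1 + real \<gamma> / real m) * (1 - \<Psi> x) + integral {x + 1 / real m..1} \<Psi>
        \<le> (1 - x) + ?q * (1 - \<Psi> x)" (is "?l \<le> _") by linarith
    \<comment> \<open>Multiplying by \<open>1 - z\<close> prepares the slope inequality, which
      trades \<open>\<Psi> x\<close> for \<open>\<Psi> z\<close> and turns the factor
      \<open>1 - z\<close> into \<open>1 - x\<close>.\<close>
    then have "(1 - z) * ?l \<le> (1 - z) * ((1 - x) + ?q * (1 - \<Psi> x))"
      using z by (intro mult_left_mono) auto
    also have "\<dots> = (1 - z) * (1 - x) + ?q * ((1 - \<Psi> x) * (1 - z))"
      by (simp only: distrib_left mult_ac)
    also have "\<dots> \<le> (1 - z) * (1 - x) + ?q * ((1 - \<Psi> z) * (1 - x))"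
      using slope by (intro add_left_mono mult_left_mono) auto
    also have "\<dots> = (1 - x) * ((1 - z) + ?q * (1 - \<Psi> z))" by (simp only: distrib_left mult_ac)
    finally have "G * ((1 - z) * ?l) \<le> G * ((1 - x) * ((1 - z) + ?q * (1 - \<Psi> z)))"
      using G by (intro mult_left_mono)
    also have "\<dots> = (1 - x) * (G * ((1 - z) + ?q * (1 - \<Psi> z)))" by simp
    also have "\<dots> \<le> (1 - x) * (Gamma1 \<Psi> c0 \<gamma> * ((1 - z) + ?q * (1 - \<Psi> z)))"
      using G x1 z \<Psi>z by (intro mult_left_mono mult_right_mono add_nonneg_nonneg mult_nonneg_nonneg) auto
    \<comment> \<open>At \<open>z\<close> the integral runs over a single point, so the bracket is
      the whole denominator of \<open>Gamma1\<close>.\<close>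
    also have "\<dots> \<le> (1 - x) * (1 - z)"
      using Gamma1_mult_le[of z c0 \<gamma>] z x1 assms by (intro mult_left_mono) (auto simp: z_def)
    finally have "(1 - z) * (G * ?l) \<le> (1 - z) * (1 - x)" by (simp add: mult_ac)
    then show ?thesis using z(3) by (simp add: mult_le_cancel_left_pos)
  qed
qed

text \<open>The initial batch is charged for its own \<open>m\<close> units and for
  \<open>\<gamma>\<close> more that stand for the charging batch. Its size is the inventory of the
  product at hand, which may exceed the smallest inventory \<open>c0\<close>.\<close>

lemma initial_batch_condition:
  assumes "concave_on {0..1} \<Psi>" and "1 \<le> c0" "c0 \<le> m" "1 \<le> \<gamma>" "1 \<le> a" "a \<le> m"
  shows "Gamma_bound \<Psi> c0 \<gamma> * (real (m + \<gamma>) * (1 - \<Psi> (1 - real a / real m))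
           + (\<Sum>k<a. \<Psi> (1 - real k / real m))) \<le> real a"
proof (rule batch_condition[OF Gamma_bound_nonneg])
  have x: "0 \<le> 1 - real a / real m" "1 - real a / real m \<le> 1 - 1 / real m"
    using assms by (auto simp: divide_simps)
  have "real (m + \<gamma>) / real m = 1 + real \<gamma> / real m"
    using assms by (simp add: field_simps)
  then show "Gamma_bound \<Psi> c0 \<gamma> * (1 / real m + real (m + \<gamma>) / real m * (1 - \<Psi> (1 - real a / real m))
            + integral {1 - real a / real m + 1 / real m..1} \<Psi>) \<le> real a / real m"
    using Gamma1_larger_stock[OF assms(1-3) x Gamma_bound_nonneg[OF assms(2,4)], of \<gamma>]
    by (simp add: Gamma_bound_def)
qed (use assms in auto)

end

section \<open>Trajectories, batches and the oracle\<close>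

lemma pmf_choice_pmf_Some:
  assumes "is_choice_model F \<phi>" "S \<in> F"
  shows "pmf (choice_pmf \<phi> S) (Some i) = \<phi> S i"
proof -
  let ?f = "\<lambda>x. case x of None \<Rightarrow> 1 - (\<Sum>i\<in>UNIV. \<phi> S i) | Some i \<Rightarrow> \<phi> S i"
  have nonneg: "0 \<le> ?f x" for x
    using assms by (auto simp: is_choice_model_def split: option.split)
  have "(\<Sum>x\<in>UNIV. ?f x) = 1"
    by (simp add: UNIV_option_conv sum.reindex)
  then have "(\<integral>\<^sup>+x. ennreal (?f x) \<partial>count_space UNIV) = 1"
    using nonneg by (subst nn_integral_count_space_finite) (simp_all add: sum_ennreal)
  note pmf = pmf_embed_pmf[OF nonneg this]
  show ?thesis
    unfolding choice_pmf_def by (simp add: pmf)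
qed

lemma expectation_choice:
  assumes "is_choice_model F \<phi>" "S \<in> F"
  shows "measure_pmf.expectation (choice_pmf \<phi> S) (case_option 0 w) = (\<Sum>i\<in>UNIV. w i * \<phi> S i)"
proof -
  have "measure_pmf.expectation (choice_pmf \<phi> S) (case_option 0 w)
      = (\<Sum>x\<in>UNIV. pmf (choice_pmf \<phi> S) x * case_option 0 w x)"
    by (subst integral_measure_pmf[of UNIV]) auto
  then show ?thesis
    by (simp add: UNIV_option_conv sum.reindex pmf_choice_pmf_Some[OF assms] mult.commute)
qed

lemma set_pmf_choice:
  assumes "is_choice_model F \<phi>" "S \<in> F" "Some i \<in> set_pmf (choice_pmf \<phi> S)"
  shows "i \<in> S"
  using assms pmf_choice_pmf_Some[OF assms(1,2), of i]
  by (auto simp: set_pmf_iff is_choice_model_def)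

lemma length_trajectory: "h \<in> set_pmf (trajectory \<phi> \<pi> t) \<Longrightarrow> length h = t"
  by (induction t arbitrary: h) auto

lemma finite_set_trajectory: "finite (set_pmf (trajectory \<phi> \<pi> t))"
  for \<phi> :: "nat \<Rightarrow> 'p::finite choice_model"
  by (induction t) auto

lemma trajectory_prefix:
  assumes "h \<in> set_pmf (trajectory \<phi> \<pi> T)"
  shows "t \<le> T \<Longrightarrow> take t h \<in> set_pmf (trajectory \<phi> \<pi> t)"
    and "t < T \<Longrightarrow> fst (h ! t) \<in> set_pmf (\<pi> (take t h))"
    and "t < T \<Longrightarrow> snd (h ! t) \<in> set_pmf (choice_pmf (\<phi> (Suc t)) (fst (h ! t)))"
proof -
  have "(t \<le> T \<longrightarrow> take t h \<in> set_pmf (trajectory \<phi> \<pi> t)) \<and>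
        (t < T \<longrightarrow> fst (h ! t) \<in> set_pmf (\<pi> (take t h)) \<and>
           snd (h ! t) \<in> set_pmf (choice_pmf (\<phi> (Suc t)) (fst (h ! t))))"
    using assms
  proof (induction T arbitrary: h)
    case (Suc T)
    then obtain g S x where g: "g \<in> set_pmf (trajectory \<phi> \<pi> T)" "S \<in> set_pmf (\<pi> g)"
        "x \<in> set_pmf (choice_pmf (\<phi> (Suc T)) S)" "h = g @ [(S, x)]"
      by auto
    note len = length_trajectory[OF g(1)]
    consider "t < T" | "t = T" | "t = Suc T" | "Suc T < t" by linarith
    then show ?case
    proof cases
      case 3
      with Suc.prems g(4) len show ?thesis by simp
    qed (use g len Suc.IH[OF g(1)] in \<open>auto simp: nth_append\<close>)
  qed auto
  then show "t \<le> T \<Longrightarrow> take t h \<in> set_pmf (trajectory \<phi> \<pi> t)"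
    and "t < T \<Longrightarrow> fst (h ! t) \<in> set_pmf (\<pi> (take t h))"
    and "t < T \<Longrightarrow> snd (h ! t) \<in> set_pmf (choice_pmf (\<phi> (Suc t)) (fst (h ! t)))"
    by auto
qed

text \<open>A supermartingale argument: if every increment has nonpositive conditional mean, then
  the total has nonpositive mean. The induction averages out the last period first. It is applied to
  the benchmark against a frozen path of BIB, and to BIB itself.\<close>

lemma expectation_trajectory_nonpos:
  fixes \<phi> :: "nat \<Rightarrow> 'p::finite choice_model" and G :: "'p history \<Rightarrow> 'p set \<times> 'p option \<Rightarrow> real"
  assumes "\<And>t h S. t < T \<Longrightarrow> h \<in> set_pmf (trajectory \<phi> \<pi> t) \<Longrightarrow> S \<in> set_pmf (\<pi> h) \<Longrightarrow>
     measure_pmf.expectation (choice_pmf (\<phi> (Suc t)) S) (\<lambda>x. G h (S, x)) \<le> 0"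
  shows "measure_pmf.expectation (trajectory \<phi> \<pi> T) (\<lambda>h. \<Sum>t<T. G (take t h) (h ! t)) \<le> 0"
  using assms
proof (induction T)
  case (Suc T)
  let ?tr = "trajectory \<phi> \<pi> T"
  let ?f = "\<lambda>h. \<Sum>t<T. G (take t h) (h ! t)"
  let ?g = "\<lambda>h. \<Sum>t<Suc T. G (take t h) (h ! t)"
  let ?step = "\<lambda>h. \<pi> h \<bind> (\<lambda>S. choice_pmf (\<phi> (Suc T)) S \<bind> (\<lambda>x. return_pmf (h @ [(S, x)])))"
  have step: "measure_pmf.expectation (?step h) ?g \<le> ?f h" if h: "h \<in> set_pmf ?tr" for h
  proof -
    note len = length_trajectory[OF h]
    have g: "?g (h @ [(S, x)]) = ?f h + G h (S, x)" for S x
      using len by (simp add: nth_append)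
    have inner: "measure_pmf.expectation (choice_pmf (\<phi> (Suc T)) S \<bind> (\<lambda>x. return_pmf (h @ [(S, x)]))) ?g \<le> ?f h"
      if S: "S \<in> set_pmf (\<pi> h)" for S
    proof -
      have "measure_pmf.expectation (choice_pmf (\<phi> (Suc T)) S \<bind> (\<lambda>x. return_pmf (h @ [(S, x)]))) ?g
          = measure_pmf.expectation (choice_pmf (\<phi> (Suc T)) S) (\<lambda>x. ?f h + G h (S, x))"
        unfolding map_pmf_def[symmetric] integral_map_pmf g ..
      also have "\<dots> = ?f h + measure_pmf.expectation (choice_pmf (\<phi> (Suc T)) S) (\<lambda>x. G h (S, x))"
        by (subst Bochner_Integration.integral_add) (auto intro: integrable_measure_pmf_finite)
      also have "\<dots> \<le> ?f h" using Suc.prems[OF _ h S] by simp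
      finally show ?thesis .
    qed
    have "measure_pmf.expectation (?step h) ?g = (\<Sum>S\<in>set_pmf (\<pi> h). pmf (\<pi> h) S *
        measure_pmf.expectation (choice_pmf (\<phi> (Suc T)) S \<bind> (\<lambda>x. return_pmf (h @ [(S, x)]))) ?g)"
      by (subst pmf_expectation_bind[of "set_pmf (\<pi> h)"]) auto
    also have "\<dots> \<le> (\<Sum>S\<in>set_pmf (\<pi> h). pmf (\<pi> h) S * ?f h)"
      using inner by (intro sum_mono mult_left_mono) auto
    also have "\<dots> = ?f h"
      by (simp add: sum_distrib_right[symmetric] sum_pmf_eq_1)
    finally show ?thesis .
  qed
  have "measure_pmf.expectation (trajectory \<phi> \<pi> (Suc T)) ?g
      = (\<Sum>h\<in>set_pmf ?tr. pmf ?tr h * measure_pmf.expectation (?step h) ?g)"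
    unfolding trajectory.simps
    by (subst pmf_expectation_bind[of "set_pmf ?tr"]) (auto simp: finite_set_trajectory)
  also have "\<dots> \<le> (\<Sum>h\<in>set_pmf ?tr. pmf ?tr h * ?f h)"
    using step by (intro sum_mono mult_left_mono) auto
  also have "\<dots> = measure_pmf.expectation ?tr ?f"
    by (subst integral_measure_pmf[of "set_pmf ?tr"]) (auto simp: finite_set_trajectory)
  also have "\<dots> \<le> 0" using Suc.prems by (intro Suc.IH) auto
  finally show ?case .
qed simp

text \<open>Each added unit raises \<open>\<gamma>\<close> times the first component plus the second
  by one, whether or not it completes a batch. The initial batch enters as one ready batch worth
  \<open>\<gamma>\<close>, whatever its true size \<open>c i\<close>.\<close>

lemma batch_state_total:
  assumes "1 \<le> \<gamma>"
  shows "1 \<le> fst (batch_state \<gamma> x t) \<and> snd (batch_state \<gamma> x t) < \<gamma> \<and>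
    \<gamma> * fst (batch_state \<gamma> x t) + snd (batch_state \<gamma> x t) = \<gamma> + (\<Sum>s=1..t. x s)"
proof (induction t)
  case (Suc t)
  have add: "1 \<le> fst ((add_unit \<gamma> ^^ k) p) \<and> snd ((add_unit \<gamma> ^^ k) p) < \<gamma> \<and>
      \<gamma> * fst ((add_unit \<gamma> ^^ k) p) + snd ((add_unit \<gamma> ^^ k) p) = \<gamma> * fst p + snd p + k"
    if "1 \<le> fst p" "snd p < \<gamma>" for k p
  proof (induction k)
    case (Suc k)
    then show ?case
      by (cases "(add_unit \<gamma> ^^ k) p") (auto simp: add_unit_def)
  qed (use that in auto)
  show ?case using add[of "batch_state \<gamma> x t" "x (Suc t)"] Suc.IH by simp
qed (use assms in auto)

lemma outstanding_window:
  "t \<le> length L \<Longrightarrow> outstanding dur y (take t L) = card (window dur {k. k < length L \<and> L ! k = y} t)"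
  unfolding outstanding_def window_def by (rule arg_cong[of _ _ card]) auto

lemma oracle_mem:
  assumes "exact_oracle F orc" "admissible F \<phi>" "\<forall>i. 0 \<le> R i"
  shows "orc t \<phi> R \<in> F"
    and "S \<in> F \<Longrightarrow> (\<Sum>i\<in>UNIV. R i * \<phi> S i) \<le> (\<Sum>i\<in>UNIV. R i * \<phi> (orc t \<phi> R) i)"
  using assms unfolding exact_oracle_def is_arg_min_def is_arg_max_def
  by (blast, metis linorder_not_less)

text \<open>
  Removing a product of reduced price zero cannot lower the value of an assortment by weak
  substitutability, so a smallest maximiser contains none.
\<close>

lemma oracle_pos:
  assumes "exact_oracle F orc" "downward_closed F" "admissible F \<phi>" "\<forall>i. 0 \<le> R i"
    and i: "i \<in> orc t \<phi> R"
  shows "0 < R i"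
proof (rule ccontr)
  assume "\<not> 0 < R i"
  with assms(4) have "R i \<ge> 0" and "\<not> 0 < R i" by auto
  then have "R i = 0" by linarith
  let ?v = "\<lambda>S. \<Sum>i\<in>UNIV. R i * \<phi> S i"
  define S where "S = orc t \<phi> R"
  have arg: "is_arg_min card (is_arg_max ?v (\<lambda>S. S \<in> F)) S"
    using assms unfolding exact_oracle_def S_def by blast
  then have S: "S \<in> F" by (simp add: is_arg_min_def is_arg_max_def)
  have S': "S - {i} \<in> F" using S assms(2) by (auto simp: downward_closed_def)
  have "insert i (S - {i}) = S" using i by (auto simp: S_def)
  then have "\<phi> S j \<le> \<phi> (S - {i}) j" if "j \<noteq> i" for j
    using assms(3) S S' that unfolding admissible_def weakly_substitutable_def by metis
  then have "?v S \<le> ?v (S - {i})"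
    using assms(4) \<open>R i = 0\<close> by (intro sum_mono) (metis mult_left_mono mult_zero_left order_refl)
  moreover have "\<not> (\<exists>y\<in>F. ?v S < ?v y)"
    using arg by (auto simp: is_arg_min_def is_arg_max_def)
  ultimately have "is_arg_max ?v (\<lambda>S. S \<in> F) (S - {i})"
    using S' by (fastforce simp: is_arg_max_def)
  moreover have "card (S - {i}) < card S"
    using i by (intro psubset_card_mono) (auto simp: S_def)
  ultimately show False using arg by (auto simp: is_arg_min_def)
qed

section \<open>Sample paths of BIB\<close>

lemma bib_log_snoc:
  "bib_log \<gamma> sel c d \<xi> (h @ [(S, x)]) = bib_log \<gamma> sel c d \<xi> h @
     [map_option (\<lambda>i. (i, sel (bib_log \<gamma> sel c d \<xi> h) i (top_batches \<gamma> c d \<xi> (bib_log \<gamma> sel c d \<xi> h) i))) x]"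
  by (simp add: bib_log_def)

lemma length_bib_log [simp]: "length (bib_log \<gamma> sel c d \<xi> h) = length h"
  by (induction h rule: rev_induct) (auto simp: bib_log_snoc, simp add: bib_log_def)

text \<open>BIB is online: its log up to a time depends only on the history up to it. Levels at
  every time can thus be read off one complete log.\<close>

lemma take_bib_log: "take t (bib_log \<gamma> sel c d \<xi> h) = bib_log \<gamma> sel c d \<xi> (take t h)"
proof (induction h rule: rev_induct)
  case Nil
  then show ?case by (simp add: bib_log_def)
next
  case (snoc p h)
  obtain S x where "p = (S, x)" by (cases p)
  then show ?case using snoc by (cases "t \<le> length h") (auto simp: bib_log_snoc)
qed

lemma bib_log_nth:
  assumes "t < length h"
  shows "bib_log \<gamma> sel c d \<xi> h ! t = map_option (\<lambda>i. (i, sel (bib_log \<gamma> sel c d \<xi> (take t h)) i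
     (top_batches \<gamma> c d \<xi> (bib_log \<gamma> sel c d \<xi> (take t h)) i))) (snd (h ! t))"
proof -
  obtain S x where "h ! t = (S, x)" by (cases "h ! t")
  then have "take (Suc t) h = take t h @ [(S, x)]" using assms by (simp add: take_Suc_conv_app_nth)
  then have "take (Suc t) (bib_log \<gamma> sel c d \<xi> h) = bib_log \<gamma> sel c d \<xi> (take t h) @
     [map_option (\<lambda>i. (i, sel (bib_log \<gamma> sel c d \<xi> (take t h)) i
     (top_batches \<gamma> c d \<xi> (bib_log \<gamma> sel c d \<xi> (take t h)) i))) x]"
    by (simp add: take_bib_log bib_log_snoc)
  from arg_cong[OF this, of "\<lambda>L. L ! t"] show ?thesis
    using assms \<open>h ! t = (S, x)\<close> by (simp add: nth_append)
qed

definition sales :: "'p sales_log \<Rightarrow> 'p \<Rightarrow> nat \<Rightarrow> nat set" where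
  "sales L i j = {k. k < length L \<and> L ! k = Some (i, j)}"

text \<open>What the accounting needs from a path of BIB, free of probability: every sale comes from
  a fullest ready batch that still has a unit. Index \<open>k\<close> belongs to period
  \<open>k + 1\<close>, hence \<open>Suc k\<close>.\<close>

definition balanced_log ::
  "nat \<Rightarrow> ('p \<Rightarrow> nat) \<Rightarrow> ('p \<Rightarrow> nat) \<Rightarrow> ('p \<Rightarrow> nat \<Rightarrow> nat) \<Rightarrow> 'p sales_log \<Rightarrow> bool" where
  "balanced_log \<gamma> c d \<xi> L \<longleftrightarrow> (\<forall>k i j. k \<in> sales L i j \<longrightarrow>
     j \<in> ready \<gamma> (\<xi> i) (Suc k) \<and>
     level \<gamma> c d (take k L) i j = top_level \<gamma> c d \<xi> (take k L) i \<and>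
     0 < level \<gamma> c d (take k L) i j)"

lemma level_window:
  "t \<le> length L \<Longrightarrow> level \<gamma> c d (take t L) i j
     = 1 - real (card (window (d i) (sales L i j) t)) / real (batch_size \<gamma> c i j)"
  by (simp add: level_def outstanding_window sales_def)

context
  fixes c d :: "'p::finite \<Rightarrow> nat" and \<gamma> :: nat and \<xi> :: "'p \<Rightarrow> nat \<Rightarrow> nat"
  assumes c: "\<forall>i. 1 \<le> c i" and \<gamma>: "1 \<le> \<gamma>"
begin

lemma batch_size_pos: "1 \<le> batch_size \<gamma> c i j"
  using c \<gamma> by (simp add: batch_size_def)

lemma card_window_sales_less:
  assumes "balanced_log \<gamma> c d \<xi> L" "s \<in> sales L i j"
  shows "card (window (d i) (sales L i j) s) < batch_size \<gamma> c i j"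
proof -
  have "0 < level \<gamma> c d (take s L) i j" using assms unfolding balanced_log_def by metis
  moreover have "s \<le> length L" using assms by (simp add: sales_def)
  ultimately show ?thesis
    using batch_size_pos[of i j] by (simp add: level_window divide_simps split: if_splits)
qed

lemma level_range:
  assumes "balanced_log \<gamma> c d \<xi> L" "t \<le> length L"
  shows "level \<gamma> c d (take t L) i j \<in> {0..1}"
proof -
  have "card (window (d i) (sales L i j) t) \<le> batch_size \<gamma> c i j"
    by (rule card_window_le) (rule card_window_sales_less[OF assms(1)])
  then show ?thesis
    using batch_size_pos[of i j] by (simp add: level_window[OF assms(2)] divide_simps)
qed

lemma ready_nonempty: "finite (ready \<gamma> x t)" "ready \<gamma> x t \<noteq> {}"
  using batch_state_total[OF \<gamma>, of x t] by (auto simp: ready_def)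

lemma top_level_range:
  assumes "balanced_log \<gamma> c d \<xi> L" "t \<le> length L"
  shows "top_level \<gamma> c d \<xi> (take t L) i \<in> {0..1}"
proof -
  let ?A = "level \<gamma> c d (take t L) i ` ready \<gamma> (\<xi> i) (Suc (length (take t L)))"
  have "Max ?A \<in> ?A" using ready_nonempty by (intro Max_in) auto
  then obtain j where "Max ?A = level \<gamma> c d (take t L) i j" by blast
  then show ?thesis using level_range[OF assms, of i j] unfolding top_level_def by simp
qed

lemma level_le_top_level:
  "j \<in> ready \<gamma> (\<xi> i) (Suc (length L)) \<Longrightarrow> level \<gamma> c d L i j \<le> top_level \<gamma> c d \<xi> L i"
  unfolding top_level_def using ready_nonempty by (intro Max_ge) auto

lemma top_batches_nonempty: "finite (top_batches \<gamma> c d \<xi> L i)" "top_batches \<gamma> c d \<xi> L i \<noteq> {}"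
proof -
  let ?A = "level \<gamma> c d L i ` ready \<gamma> (\<xi> i) (Suc (length L))"
  show "finite (top_batches \<gamma> c d \<xi> L i)"
    unfolding top_batches_def using ready_nonempty(1) by auto
  have "Max ?A \<in> ?A" using ready_nonempty by (intro Max_in) auto
  then show "top_batches \<gamma> c d \<xi> L i \<noteq> {}"
    unfolding top_batches_def top_level_def by auto
qed

context
  fixes \<Psi> :: "real \<Rightarrow> real" and orc :: "'p oracle_fun" and sel :: "'p batch_rule"
    and F :: "'p set set" and r :: "'p \<Rightarrow> real" and \<phi> :: "nat \<Rightarrow> 'p choice_model" and T :: nat
  assumes r: "\<forall>i. 0 \<le> r i" and down: "downward_closed F"
    and orc: "exact_oracle F orc" and sel: "valid_batch_rule sel"
    and range: "\<Psi> ` {0..1} \<subseteq> {0..1}" and zero: "\<Psi> 0 = 0"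
    and adm: "\<forall>t\<in>{1..T}. admissible F (\<phi> t)"
begin

lemma reduced_price_nonneg:
  assumes "balanced_log \<gamma> c d \<xi> L"
  shows "0 \<le> r i * \<Psi> (top_level \<gamma> c d \<xi> L i)"
proof -
  have "\<Psi> (top_level \<gamma> c d \<xi> L i) \<in> {0..1}"
    using top_level_range[OF assms order_refl, of i] range by (simp add: image_subset_iff)
  then show ?thesis using r by simp
qed

text \<open>The offer of BIB is never checked against the stock. Availability follows because a
  product at top level zero has reduced price zero by \<open>\<Psi> 0 = 0\<close>, and a smallest
  maximiser contains no such product.\<close>

lemma balanced_bib_log:
  assumes "t \<le> T" "h \<in> set_pmf (trajectory \<phi> (BIB \<Psi> \<gamma> orc sel c d r \<phi> \<xi>) t)"
  shows "balanced_log \<gamma> c d \<xi> (bib_log \<gamma> sel c d \<xi> h)"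
  using assms
proof (induction t arbitrary: h)
  case 0
  then show ?case by (simp add: bib_log_def balanced_log_def sales_def)
next
  case (Suc t)
  let ?\<pi> = "BIB \<Psi> \<gamma> orc sel c d r \<phi> \<xi>"
  from Suc.prems(2) obtain g S x where g: "g \<in> set_pmf (trajectory \<phi> ?\<pi> t)"
      and S: "S \<in> set_pmf (?\<pi> g)" and x: "x \<in> set_pmf (choice_pmf (\<phi> (Suc t)) S)" and h: "h = g @ [(S, x)]"
    by auto
  have S_eq: "S = bib_offer \<Psi> \<gamma> orc c d r \<phi> \<xi> (bib_log \<gamma> sel c d \<xi> g)"
    using S by (simp add: BIB_def)
  have x: "x \<in> set_pmf (choice_pmf (\<phi> (Suc t)) (bib_offer \<Psi> \<gamma> orc c d r \<phi> \<xi> (bib_log \<gamma> sel c d \<xi> g)))"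
    using x unfolding S_eq .
  define L where "L = bib_log \<gamma> sel c d \<xi> g"
  define R where "R = (\<lambda>i. r i * \<Psi> (top_level \<gamma> c d \<xi> L i))"
  have L: "balanced_log \<gamma> c d \<xi> L" unfolding L_def using Suc.IH g Suc.prems by auto
  have len: "length L = t" unfolding L_def using length_trajectory[OF g] by simp
  have adm': "admissible F (\<phi> (Suc t))" using adm Suc.prems by auto
  then have cm: "is_choice_model F (\<phi> (Suc t))" by (simp add: admissible_def)
  have R: "\<forall>i. 0 \<le> R i" unfolding R_def using reduced_price_nonneg[OF L] by blast
  have offer: "bib_offer \<Psi> \<gamma> orc c d r \<phi> \<xi> L = orc (Suc t) (\<phi> (Suc t)) R"
    by (simp add: bib_offer_def R_def len)
  define L' where "L' = bib_log \<gamma> sel c d \<xi> h"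
  have L': "L' = L @ [map_option (\<lambda>i. (i, sel L i (top_batches \<gamma> c d \<xi> L i))) x]"
    unfolding L'_def h bib_log_snoc L_def ..
  have "balanced_log \<gamma> c d \<xi> L'"
    unfolding balanced_log_def
  proof (intro allI impI)
    fix k i j assume k: "k \<in> sales L' i j"
    show "j \<in> ready \<gamma> (\<xi> i) (Suc k) \<and>
        level \<gamma> c d (take k L') i j = top_level \<gamma> c d \<xi> (take k L') i \<and> 0 < level \<gamma> c d (take k L') i j"
    proof (cases "k < length L")
      case True
      with k have "k \<in> sales L i j" by (auto simp: sales_def L' nth_append)
      moreover have "take k L' = take k L" using True by (simp add: L')
      ultimately show ?thesis using L unfolding balanced_log_def by metis
    next
      case False
      with k have kt: "k = t" by (auto simp: sales_def L' len)
      with k have x': "x = Some i" "j = sel L i (top_batches \<gamma> c d \<xi> L i)"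
        by (auto simp: sales_def L' len[symmetric])
      have "j \<in> top_batches \<gamma> c d \<xi> L i"
        using sel top_batches_nonempty[of L i] x'(2) unfolding valid_batch_rule_def by simp
      then have j: "j \<in> ready \<gamma> (\<xi> i) (Suc t)" "level \<gamma> c d L i j = top_level \<gamma> c d \<xi> L i"
        by (auto simp: top_batches_def len)
      have "i \<in> orc (Suc t) (\<phi> (Suc t)) R"
        using x x'(1) set_pmf_choice[OF cm oracle_mem(1)[OF orc adm' R]] offer by (simp add: L_def)
      then have "0 < R i" by (rule oracle_pos[OF orc down adm' R])
      then have "top_level \<gamma> c d \<xi> L i \<noteq> 0" using zero by (auto simp: R_def)
      moreover have "0 \<le> top_level \<gamma> c d \<xi> L i"
        using top_level_range[OF L order_refl, of i] by simp
      ultimately show ?thesis using j kt len by (simp add: L')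
    qed
  qed
  then show ?case by (simp add: L'_def)
qed

end

end

section \<open>From sample paths to expected revenue\<close>

lemma expectation_mono_finite:
  fixes f g :: "'a \<Rightarrow> real"
  assumes "finite (set_pmf M)" "\<And>x. x \<in> set_pmf M \<Longrightarrow> f x \<le> g x"
  shows "measure_pmf.expectation M f \<le> measure_pmf.expectation M g"
  using assms by (intro integral_mono_AE) (auto simp: AE_measure_pmf_iff intro: integrable_measure_pmf_finite)

lemma sum_by_product:
  fixes x :: "nat \<Rightarrow> 'p::finite option" and u :: "nat \<Rightarrow> 'p \<Rightarrow> real"
  shows "(\<Sum>t<T. case_option 0 (u t) (x t)) = (\<Sum>i\<in>UNIV. \<Sum>t | t < T \<and> x t = Some i. u t i)"
proof -
  have "case_option 0 (u t) (x t) = (\<Sum>i\<in>UNIV. if x t = Some i then u t i else 0)" for t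
    by (cases "x t") (auto simp: sum.delta')
  then have "(\<Sum>t<T. case_option 0 (u t) (x t)) = (\<Sum>i\<in>UNIV. \<Sum>t<T. if x t = Some i then u t i else 0)"
    by (simp only: sum.swap[of _ "{..<T}"])
  also have "\<dots> = (\<Sum>i\<in>UNIV. \<Sum>t | t < T \<and> x t = Some i. u t i)"
  proof (rule sum.cong[OF refl])
    fix i
    have "{t. t < T \<and> x t = Some i} = {t \<in> {..<T}. x t = Some i}" by auto
    then show "(\<Sum>t<T. if x t = Some i then u t i else 0) = (\<Sum>t | t < T \<and> x t = Some i. u t i)"
      by (simp only: sum.inter_filter[OF finite_lessThan])
  qed
  finally show ?thesis .
qed

lemma expected_revenue_sum:
  fixes \<phi> :: "nat \<Rightarrow> 'p::finite choice_model"
  shows "expected_revenue r \<phi> T \<pi>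
    = measure_pmf.expectation (trajectory \<phi> \<pi> T) (\<lambda>h. \<Sum>t<T. case_option 0 r (snd (h ! t)))"
  unfolding expected_revenue_def
proof (rule integral_cong_AE)
  show "AE h in trajectory \<phi> \<pi> T. (\<Sum>(S, x)\<leftarrow>h. case x of None \<Rightarrow> 0 | Some i \<Rightarrow> r i)
      = (\<Sum>t<T. case_option 0 r (snd (h ! t)))"
    unfolding AE_measure_pmf_iff
  proof
    fix h assume "h \<in> set_pmf (trajectory \<phi> \<pi> T)"
    then show "(\<Sum>(S, x)\<leftarrow>h. case x of None \<Rightarrow> 0 | Some i \<Rightarrow> r i) = (\<Sum>t<T. case_option 0 r (snd (h ! t)))"
      using length_trajectory[of h \<phi> \<pi> T] by (simp add: sum_list_sum_nth case_prod_beta atLeast0LessThan)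
  qed
qed auto

text \<open>No coupling of the two paths is assumed. What links them is the supply: the benchmark
  never has more units out than exist, which bounds the number of colours that its sales
  require.\<close>

lemma pathwise_product_inequality:
  fixes c d :: "'p::finite \<Rightarrow> nat"
  assumes c: "\<forall>i. 1 \<le> c i" and \<gamma>: "1 \<le> \<gamma>" and c0: "1 \<le> c0" "c0 \<le> c i"
    and \<Psi>: "\<Psi> ` {0..1} \<subseteq> {0..1}" "\<Psi> 1 = 1" "mono_on {0..1} \<Psi>" "continuous_on {0..1} \<Psi>"
      "concave_on {0..1} \<Psi>"
    and L: "balanced_log \<gamma> c d \<xi> L" and len: "length L = T" "length g = T"
    and feas: "\<And>t. t < T \<Longrightarrow> snd (g ! t) = Some i \<Longrightarrow> 0 < inventory c d \<xi> (take t g) i"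
  defines "X \<equiv> {t. t < T \<and> (\<exists>j. L ! t = Some (i, j))}"
    and "Y \<equiv> {t. t < T \<and> snd (g ! t) = Some i}"
    and "f \<equiv> \<lambda>t. top_level \<gamma> c d \<xi> (take t L) i"
  shows "Gamma_bound \<Psi> c0 \<gamma> * ((\<Sum>t\<in>X. \<Psi> (f t)) + (\<Sum>t\<in>Y. 1 - \<Psi> (f t))) \<le> real (card X)"
proof -
  define h where "h = (\<lambda>t. fst (batch_state \<gamma> (\<xi> i) (Suc t)))"
  \<comment> \<open>A common bound on the numbers of ready batches; taking the sum also covers
    \<open>T = 0\<close>.\<close>
  define H where "H = (\<Sum>t<T. h t)"
  \<comment> \<open>The charging batch holds fewer than \<open>\<gamma>\<close> units.  The benchmark may sell them, and they are charged
     to the initial batch; this is the source of the factor \<open>1 + \<gamma> / c0\<close> in \<open>Gamma1\<close>.\<close>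
  define K where "K = (\<lambda>j::nat. (if j = 1 then c i else 0) + \<gamma>)"
  have hH: "h t \<le> H" if "t < T" for t
    unfolding H_def using that by (intro member_le_sum) auto
  have ready: "ready \<gamma> (\<xi> i) (Suc t) = {1..h t}" for t by (simp add: ready_def h_def)
  have X: "X = (\<Union>j\<in>{1..H}. sales L i j)"
  proof
    show "(\<Union>j\<in>{1..H}. sales L i j) \<subseteq> X" by (auto simp: sales_def X_def len)
    show "X \<subseteq> (\<Union>j\<in>{1..H}. sales L i j)"
    proof
      fix t assume "t \<in> X"
      then obtain j where t: "t < T" "t \<in> sales L i j" by (auto simp: sales_def X_def len)
      then have "j \<in> {1..h t}" using L unfolding balanced_log_def ready[symmetric] by blast
      with hH[OF t(1)] t show "t \<in> (\<Union>j\<in>{1..H}. sales L i j)" by auto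
    qed
  qed
  show ?thesis unfolding X
  proof (rule product_inequality[where \<Psi> = \<Psi> and top = f and A = "sales L i"
        and m = "batch_size \<gamma> c i" and K = K and d = "d i" and h = h])
    show "finite (sales L i j)" for j by (simp add: sales_def)
    show "finite Y" by (simp add: Y_def)
    show "1 \<le> batch_size \<gamma> c i j" for j by (rule batch_size_pos[OF c \<gamma>])
    show "1 \<le> K j" for j using \<gamma> by (simp add: K_def)
    show "0 \<le> Gamma_bound \<Psi> c0 \<gamma>" "Gamma_bound \<Psi> c0 \<gamma> \<le> 1"
      using Gamma_bound_nonneg Gamma_bound_le_one \<Psi> c0 \<gamma> by blast+
    show "card (window (d i) (sales L i j) s) < batch_size \<gamma> c i j" if "s \<in> sales L i j" for j s
      by (rule card_window_sales_less[OF c \<gamma> L that])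
    show "Gamma_bound \<Psi> c0 \<gamma> * (real (K j) * (1 - \<Psi> (1 - real a / real (batch_size \<gamma> c i j)))
        + (\<Sum>k<a. \<Psi> (1 - real k / real (batch_size \<gamma> c i j)))) \<le> real a"
      if "1 \<le> a" "a \<le> batch_size \<gamma> c i j" for j a
      using initial_batch_condition[OF \<Psi>(1-4) \<Psi>(5) c0 \<gamma> that(1)] later_batch_condition[OF \<Psi>(1-4) c0(1) that(1)] that(2)
      by (cases "j = 1") (simp_all add: K_def batch_size_def)
    show "sales L i j \<inter> sales L i j' = {}" if "j \<noteq> j'" for j j'
      using that by (auto simp: sales_def)
    show "f s = 1 - real (card (window (d i) (sales L i j) s)) / real (batch_size \<gamma> c i j)"
      if "s \<in> sales L i j" for j s
    proof -
      have "s \<le> length L" using that by (simp add: sales_def)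
      then show ?thesis using L that by (auto simp: balanced_log_def f_def level_window[symmetric])
    qed
    show "1 - real (card (window (d i) (sales L i j) t)) / real (batch_size \<gamma> c i j) \<le> f t"
      if "t \<in> Y" "j \<in> {1..h t}" for j t
      using that level_le_top_level[OF c \<gamma>, of j \<xi> i "take t L"] ready[of t]
      by (simp add: f_def Y_def level_window[symmetric] len)
    show "f t \<le> 1" if "t \<in> Y" for t
      using that top_level_range[OF c \<gamma> L, of t i] by (simp add: f_def Y_def len)
    show "h t \<le> H" if "t \<in> Y" for t using that hH by (simp add: Y_def)
    show "card (window (d i) Y t) < (\<Sum>j=1..h t. K j)" if "t \<in> Y" for t
    proof -
      have t: "t < T" "snd (g ! t) = Some i" using that by (auto simp: Y_def)
      have "{k. k < length (map snd g) \<and> map snd g ! k = Some i} = Y"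
        by (auto simp: Y_def len)
      then have "outstanding (d i) (Some i) (map snd (take t g)) = card (window (d i) Y t)"
        using outstanding_window[of t "map snd g" "d i" "Some i"] t len by (simp add: take_map)
      with feas[OF t] have "int (card (window (d i) Y t)) < int (c i + (\<Sum>s=1..Suc t. \<xi> i s))"
        using t len unfolding inventory_def by simp
      then have "card (window (d i) Y t) < c i + (\<Sum>s=1..Suc t. \<xi> i s)" by linarith
      \<comment> \<open>The existing units are the \<open>c i\<close> initial ones,
        \<open>h t - 1\<close> full batches of size \<open>\<gamma>\<close> and fewer than
        \<open>\<gamma>\<close> charging units. Rounding the last number up to
        \<open>\<gamma>\<close> gives the sum of all \<open>K j\<close>.\<close>
      also have "\<dots> \<le> c i + \<gamma> * h t"
        using batch_state_total[OF \<gamma>, of "\<xi> i" "Suc t"] unfolding h_def by linarith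
      also have "\<dots> = (\<Sum>j=1..h t. K j)"
        using batch_state_total[OF \<gamma>, of "\<xi> i" "Suc t"] unfolding K_def h_def
        by (simp add: sum.distrib)
      finally show ?thesis .
    qed
  qed (use \<Psi> in auto)
qed

text \<open>The two trajectories are averaged separately: with a path of BIB fixed, its reduced
  prices are constants, and the path of the benchmark is integrated out first. The oracle controls
  the reduced part of the benchmark revenue, and the pathwise inequality pays for the rest.\<close>

lemma bib_vs_policy:
  fixes c d :: "'p::finite \<Rightarrow> nat" and r :: "'p \<Rightarrow> real" and F :: "'p set set"
    and orc :: "'p oracle_fun" and sel :: "'p batch_rule"
  assumes c: "\<forall>i. 1 \<le> c i" and r: "\<forall>i. 0 \<le> r i" and c0: "1 \<le> c0" "\<And>i. c0 \<le> c i"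
    and down: "downward_closed F" and orc: "exact_oracle F orc" and sel: "valid_batch_rule sel"
    and \<Psi>: "\<Psi> ` {0..1} \<subseteq> {0..1}" "\<Psi> 1 = 1" "mono_on {0..1} \<Psi>" "continuous_on {0..1} \<Psi>"
      "concave_on {0..1} \<Psi>" and zero: "\<Psi> 0 = 0"
    and \<gamma>: "1 \<le> \<gamma>"
    and adm: "\<forall>t\<in>{1..T}. admissible F (\<phi> t)"
    and feas: "feasible_policy c d F \<phi> \<xi> T \<pi>"
  shows "Gamma_bound \<Psi> c0 \<gamma> * expected_revenue r \<phi> T \<pi>
           \<le> expected_revenue r \<phi> T (BIB \<Psi> \<gamma> orc sel c d r \<phi> \<xi>)"
proof -
  let ?B = "trajectory \<phi> (BIB \<Psi> \<gamma> orc sel c d r \<phi> \<xi>)" and ?P = "trajectory \<phi> \<pi>"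
  let ?G = "Gamma_bound \<Psi> c0 \<gamma>"
  define log where "log = bib_log \<gamma> sel c d \<xi>"
  define w where "w = (\<lambda>h i. r i * \<Psi> (top_level \<gamma> c d \<xi> (log h) i))"
  define off where "off = (\<lambda>h. bib_offer \<Psi> \<gamma> orc c d r \<phi> \<xi> (log h))"
  \<comment> \<open>For reachable \<open>h\<close>, the optimal value of the oracle's problem after
    \<open>h\<close>, which is the conditional mean of the reduced price that BIB collects
    next.\<close>
  define lam where "lam = (\<lambda>h. \<Sum>i\<in>UNIV. w h i * \<phi> (Suc (length h)) (off h) i)"
  have cm: "is_choice_model F (\<phi> (Suc t))" if "t < T" for t
    using adm that by (simp add: admissible_def)
  have bal: "balanced_log \<gamma> c d \<xi> (log h)" if "t \<le> T" "h \<in> set_pmf (?B t)" for h t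
    unfolding log_def by (rule balanced_bib_log[OF c \<gamma> r down orc sel \<Psi>(1) zero adm that])
  have w_nonneg: "0 \<le> w h i" if "t \<le> T" "h \<in> set_pmf (?B t)" for h t i
    unfolding w_def
    by (rule reduced_price_nonneg[OF c \<gamma> r down orc sel \<Psi>(1) zero adm bal[OF that]])
  have off_eq: "off h = orc (Suc (length h)) (\<phi> (Suc (length h))) (w h)" for h
    by (simp add: off_def bib_offer_def w_def log_def)
  have off_F: "off h \<in> F"
    and off_best: "S \<in> F \<Longrightarrow> (\<Sum>i\<in>UNIV. w h i * \<phi> (Suc t) S i) \<le> lam h"
    if "t < T" "h \<in> set_pmf (?B t)" for h t S
  proof -
    have len: "length h = t" by (rule length_trajectory[OF that(2)])
    have a: "admissible F (\<phi> (Suc t))" using adm that by simp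
    have wn: "\<forall>i. 0 \<le> w h i" using w_nonneg[of t h] that by simp
    show "off h \<in> F" unfolding off_eq len by (rule oracle_mem(1)[OF orc a wn])
    show "S \<in> F \<Longrightarrow> (\<Sum>i\<in>UNIV. w h i * \<phi> (Suc t) S i) \<le> lam h"
      unfolding lam_def off_eq len by (rule oracle_mem(2)[OF orc a wn])
  qed
  have intB: "integrable (?B T) u" and intP: "integrable (?P T) v" for u v :: "'p history \<Rightarrow> real"
    by (intro integrable_measure_pmf_finite finite_set_trajectory)+

  have policy_side: "measure_pmf.expectation (?P T) (\<lambda>g. \<Sum>t<T. case_option 0 (w (take t h)) (snd (g ! t)))
      \<le> (\<Sum>t<T. lam (take t h))" if h: "h \<in> set_pmf (?B T)" for h
  proof -
    let ?D = "\<lambda>g p. case_option 0 (w (take (length g) h)) (snd p) - lam (take (length g) h)"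
    have "measure_pmf.expectation (?P T) (\<lambda>g. (\<Sum>t<T. case_option 0 (w (take t h)) (snd (g ! t))) - (\<Sum>t<T. lam (take t h)))
        \<le> measure_pmf.expectation (?P T) (\<lambda>g. \<Sum>t<T. ?D (take t g) (g ! t))"
    proof (rule expectation_mono_finite[OF finite_set_trajectory])
      fix g assume "g \<in> set_pmf (?P T)"
      then have "length g = T" by (rule length_trajectory)
      then show "(\<Sum>t<T. case_option 0 (w (take t h)) (snd (g ! t))) - (\<Sum>t<T. lam (take t h))
          \<le> (\<Sum>t<T. ?D (take t g) (g ! t))"
        unfolding sum_subtractf[symmetric] by (intro sum_mono) (simp split: option.split)
    qed
    also have "\<dots> \<le> 0"
    proof (rule expectation_trajectory_nonpos)
      fix t g S assume t: "t < T" and g: "g \<in> set_pmf (?P t)" and S: "S \<in> set_pmf (\<pi> g)"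
      have len: "length g = t" by (rule length_trajectory[OF g])
      have SF: "S \<in> F" using feas t g S unfolding feasible_policy_def by blast
      have "measure_pmf.expectation (choice_pmf (\<phi> (Suc t)) S) (\<lambda>x. ?D g (S, x))
          = (\<Sum>i\<in>UNIV. w (take t h) i * \<phi> (Suc t) S i) - lam (take t h)"
        by (simp add: len integrable_measure_pmf_finite expectation_choice[OF cm[OF t] SF])
      also have "\<dots> \<le> 0"
        using off_best[OF t _ SF] trajectory_prefix(1)[OF h] t by simp
      finally show "measure_pmf.expectation (choice_pmf (\<phi> (Suc t)) S) (\<lambda>x. ?D g (S, x)) \<le> 0" .
    qed
    finally show ?thesis by (simp add: intP)
  qed

  \<comment> \<open>Each increment has mean zero, as \<open>lam h\<close> is the mean of the reduced
    price under BIB's own offer.\<close>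
  have bib_side: "measure_pmf.expectation (?B T)
      (\<lambda>h. \<Sum>t<T. lam (take t h) - case_option 0 (w (take t h)) (snd (h ! t))) \<le> 0"
  proof (rule expectation_trajectory_nonpos[where G = "\<lambda>h p. lam h - case_option 0 (w h) (snd p)"])
    fix t h S assume t: "t < T" and h: "h \<in> set_pmf (?B t)" and S: "S \<in> set_pmf (BIB \<Psi> \<gamma> orc sel c d r \<phi> \<xi> h)"
    have len: "length h = t" by (rule length_trajectory[OF h])
    have "S = off h" using S by (simp add: BIB_def off_def log_def)
    then show "measure_pmf.expectation (choice_pmf (\<phi> (Suc t)) S) (\<lambda>x. lam h - case_option 0 (w h) (snd (S, x))) \<le> 0"
      by (simp add: integrable_measure_pmf_finite expectation_choice[OF cm[OF t] off_F[OF t h]])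
         (simp add: lam_def len)
  qed

  \<comment> \<open>The product inequalities, weighted by the prices \<open>r i\<close> and added
    up.\<close>
  have path: "?G * (\<Sum>t<T. case_option 0 (w (take t h)) (snd (h ! t)))
      + ?G * (\<Sum>t<T. case_option 0 (\<lambda>i. r i - w (take t h) i) (snd (g ! t)))
      \<le> (\<Sum>t<T. case_option 0 r (snd (h ! t)))"
    if h: "h \<in> set_pmf (?B T)" and g: "g \<in> set_pmf (?P T)" for h g
  proof -
    define f where "f = (\<lambda>i t. top_level \<gamma> c d \<xi> (take t (log h)) i)"
    have w: "w (take t h) i = r i * \<Psi> (f i t)" for t i
      by (simp add: w_def f_def log_def take_bib_log)
    have len: "length h = T" "length g = T" by (rule length_trajectory[OF h], rule length_trajectory[OF g])
    have prod: "?G * ((\<Sum>t | t < T \<and> snd (h ! t) = Some i. \<Psi> (f i t))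
        + (\<Sum>t | t < T \<and> snd (g ! t) = Some i. 1 - \<Psi> (f i t))) \<le> real (card {t. t < T \<and> snd (h ! t) = Some i})" for i
    proof -
      have X: "{t. t < T \<and> snd (h ! t) = Some i} = {t. t < T \<and> (\<exists>j. log h ! t = Some (i, j))}"
        by (auto simp: log_def bib_log_nth len)
      have feas': "0 < inventory c d \<xi> (take t g) i" if t: "t < T" "snd (g ! t) = Some i" for t
      proof -
        note pre = trajectory_prefix[OF g]
        have "fst (g ! t) \<in> F" "\<forall>i\<in>fst (g ! t). 0 < inventory c d \<xi> (take t g) i"
          using feas pre(1)[of t] pre(2)[of t] t unfolding feasible_policy_def by auto
        \<comment> \<open>A realised choice belongs to the offered assortment, which the policy may
          only fill with products in stock.\<close>
        moreover from this(1) have "i \<in> fst (g ! t)"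
          using set_pmf_choice[OF cm[OF t(1)]] pre(3)[of t] t by auto
        ultimately show ?thesis by blast
      qed
      show ?thesis unfolding X f_def
        by (rule pathwise_product_inequality[OF c \<gamma> c0 \<Psi> bal[OF order_refl h]])
           (use feas' len in \<open>simp_all add: log_def\<close>)
    qed
    have "?G * (\<Sum>t<T. case_option 0 (w (take t h)) (snd (h ! t)))
        + ?G * (\<Sum>t<T. case_option 0 (\<lambda>i. r i - w (take t h) i) (snd (g ! t)))
      = (\<Sum>i\<in>UNIV. r i * (?G * ((\<Sum>t | t < T \<and> snd (h ! t) = Some i. \<Psi> (f i t))
        + (\<Sum>t | t < T \<and> snd (g ! t) = Some i. 1 - \<Psi> (f i t)))))"
      unfolding sum_by_product w sum_distrib_left[of ?G _ UNIV] sum.distrib[symmetric]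
    proof (rule sum.cong[OF refl])
      fix i
      let ?X = "{t. t < T \<and> snd (h ! t) = Some i}" and ?Y = "{t. t < T \<and> snd (g ! t) = Some i}"
      have "(\<Sum>t\<in>?X. r i * \<Psi> (f i t)) = r i * (\<Sum>t\<in>?X. \<Psi> (f i t))"
        by (simp only: sum_distrib_left)
      moreover have "(\<Sum>t\<in>?Y. r i - r i * \<Psi> (f i t)) = r i * (\<Sum>t\<in>?Y. 1 - \<Psi> (f i t))"
        by (simp only: sum_distrib_left right_diff_distrib mult_1_right)
      ultimately show "?G * (\<Sum>t\<in>?X. r i * \<Psi> (f i t)) + ?G * (\<Sum>t\<in>?Y. r i - r i * \<Psi> (f i t))
          = r i * (?G * ((\<Sum>t\<in>?X. \<Psi> (f i t)) + (\<Sum>t\<in>?Y. 1 - \<Psi> (f i t))))"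
        by (simp only: distrib_left mult.left_commute)
    qed
    also have "\<dots> \<le> (\<Sum>i\<in>UNIV. r i * real (card {t. t < T \<and> snd (h ! t) = Some i}))"
      using prod r by (intro sum_mono mult_left_mono) auto
    also have "\<dots> = (\<Sum>t<T. case_option 0 r (snd (h ! t)))"
      unfolding sum_by_product by (simp add: mult.commute)
    finally show ?thesis .
  qed

  have G0: "0 \<le> ?G" by (rule Gamma_bound_nonneg[OF \<Psi>(1-4) c0(1) \<gamma>])
  define Rev where "Rev = expected_revenue r \<phi> T \<pi>"
  \<comment> \<open>The benchmark path is averaged out with \<open>h\<close> fixed. The sum
    multiplied by \<open>?G\<close> on the right has nonpositive mean by \<open>bib_side\<close>, so
    averaging over \<open>h\<close> finishes the comparison.\<close>
  have main: "?G * Rev \<le> ?G * (\<Sum>t<T. lam (take t h) - case_option 0 (w (take t h)) (snd (h ! t)))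
      + (\<Sum>t<T. case_option 0 r (snd (h ! t)))" if h: "h \<in> set_pmf (?B T)" for h
  proof -
    let ?W = "\<lambda>g. \<Sum>t<T. case_option 0 (w (take t h)) (snd (g ! t))"
    let ?V = "\<lambda>g. \<Sum>t<T. case_option 0 (\<lambda>i. r i - w (take t h) i) (snd (g ! t))"
    have "(\<Sum>t<T. case_option 0 r (snd (g ! t))) = ?W g + ?V g" for g :: "'p history"
      unfolding sum.distrib[symmetric] by (intro sum.cong refl) (simp split: option.split)
    then have "Rev = measure_pmf.expectation (?P T) ?W + measure_pmf.expectation (?P T) ?V"
      unfolding Rev_def expected_revenue_sum by (simp add: intP)
    then have "?G * Rev = ?G * measure_pmf.expectation (?P T) ?W + measure_pmf.expectation (?P T) (\<lambda>g. ?G * ?V g)"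
      by (simp add: distrib_left)
    also have "measure_pmf.expectation (?P T) (\<lambda>g. ?G * ?V g)
        \<le> measure_pmf.expectation (?P T) (\<lambda>g. (\<Sum>t<T. case_option 0 r (snd (h ! t))) - ?G * ?W h)"
      by (rule expectation_mono_finite[OF finite_set_trajectory]) (use path[OF h] in \<open>simp add: algebra_simps\<close>)
    also have "\<dots> = (\<Sum>t<T. case_option 0 r (snd (h ! t))) - ?G * ?W h" by simp
    also have "?G * measure_pmf.expectation (?P T) ?W \<le> ?G * (\<Sum>t<T. lam (take t h))"
      by (rule mult_left_mono[OF policy_side[OF h] G0])
    finally show ?thesis by (simp add: sum_subtractf right_diff_distrib)
  qed
  have "?G * Rev = measure_pmf.expectation (?B T) (\<lambda>_. ?G * Rev)" by simp
  also have "\<dots> \<le> measure_pmf.expectation (?B T) (\<lambda>h.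
      ?G * (\<Sum>t<T. lam (take t h) - case_option 0 (w (take t h)) (snd (h ! t)))
      + (\<Sum>t<T. case_option 0 r (snd (h ! t))))"
    by (rule expectation_mono_finite[OF finite_set_trajectory main])
  also have "\<dots> = ?G * measure_pmf.expectation (?B T)
        (\<lambda>h. \<Sum>t<T. lam (take t h) - case_option 0 (w (take t h)) (snd (h ! t)))
      + expected_revenue r \<phi> T (BIB \<Psi> \<gamma> orc sel c d r \<phi> \<xi>)"
    unfolding expected_revenue_sum
    by (subst Bochner_Integration.integral_add[OF intB intB]) simp
  also have "\<dots> \<le> expected_revenue r \<phi> T (BIB \<Psi> \<gamma> orc sel c d r \<phi> \<xi>)"
    using mult_left_mono[OF bib_side G0] by simp
  finally show ?thesis by (simp add: Rev_def)
qed

section \<open>From single policies to the offline benchmark\<close>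

theorem theorem1:
  fixes c d :: "'p::finite \<Rightarrow> nat" and r :: "'p \<Rightarrow> real" and F :: "'p set set"
    and \<Psi> :: "real \<Rightarrow> real" and \<gamma> c0 :: nat
    and orc :: "'p oracle_fun" and sel :: "'p batch_rule"
  assumes "\<And>i. 1 \<le> c i" and "\<And>i. 1 \<le> d i" and "\<And>i. 0 \<le> r i"
    and "c0 = Min (range c)"
    and "F \<noteq> {}" and "downward_closed F"
    and "exact_oracle F orc" and "valid_batch_rule sel"
    and "\<Psi> ` {0..1} \<subseteq> {0..1}" and "\<Psi> 0 = 0" and "\<Psi> 1 = 1"
    and "mono_on {0..1} \<Psi>" and "concave_on {0..1} \<Psi>" and "\<Psi> differentiable_on {0..1}"
    and "1 \<le> \<gamma>" and "\<gamma> \<le> c0"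
  shows "ereal (Gamma_bound \<Psi> c0 \<gamma>)
           \<le> competitive_ratio c d r F (BIB \<Psi> \<gamma> orc sel c d r) \<and>
         (\<forall>T \<phi> \<xi>. 1 \<le> T \<and> (\<forall>t\<in>{1..T}. admissible F (\<phi> t)) \<longrightarrow>
           Gamma_bound \<Psi> c0 \<gamma> * OPT c d r F \<phi> \<xi> T
             \<le> expected_revenue r \<phi> T (BIB \<Psi> \<gamma> orc sel c d r \<phi> \<xi>))"
proof -
  let ?G = "Gamma_bound \<Psi> c0 \<gamma>" and ?Rev = "\<lambda>T \<phi> \<xi>. expected_revenue r \<phi> T (BIB \<Psi> \<gamma> orc sel c d r \<phi> \<xi>)"
  have c0: "1 \<le> c0" "c0 \<le> c i" for i
    using assms(15,16) by (linarith, simp add: assms(4))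
  have cont: "continuous_on {0..1} \<Psi>"
    using assms(14) by (rule differentiable_imp_continuous_on)
  have G0: "0 \<le> ?G"
    by (rule Gamma_bound_nonneg[OF assms(9,11,12) cont c0(1) assms(15)])
  have bound: "?G * OPT c d r F \<phi> \<xi> T \<le> ?Rev T \<phi> \<xi>"
    if adm: "\<forall>t\<in>{1..T}. admissible F (\<phi> t)" for T \<phi> \<xi>
  proof -
    have le: "?G * expected_revenue r \<phi> T \<pi> \<le> ?Rev T \<phi> \<xi>" if "feasible_policy c d F \<phi> \<xi> T \<pi>" for \<pi>
      using assms(1,3)
      by (intro bib_vs_policy[OF _ _ c0 assms(6-9,11,12) cont assms(13,10,15) adm that]) auto
    \<comment> \<open>Offering nothing is always feasible, so the supremum ranges over a nonempty
      set of policies.\<close>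
    have "{} \<in> F" using assms(5,6) unfolding downward_closed_def by blast
    then have feas: "feasible_policy c d F \<phi> \<xi> T (\<lambda>_. return_pmf {})"
      by (simp add: feasible_policy_def)
    show ?thesis
    proof (cases "?G = 0")
      \<comment> \<open>Without a positive factor to divide by, the claim is that the revenue of BIB
        is nonnegative, and the bound for any one feasible policy yields this.\<close>
      case True
      then show ?thesis using le[OF feas] by simp
    next
      case False
      with G0 have G: "0 < ?G" by simp
      have "OPT c d r F \<phi> \<xi> T \<le> ?Rev T \<phi> \<xi> / ?G"
        unfolding OPT_def
        by (rule cSUP_least) (use feas le G in \<open>auto simp: pos_le_divide_eq mult.commute\<close>)
      then show ?thesis using G by (simp add: pos_le_divide_eq mult.commute)
    qed
  qed
  have "ereal ?G \<le> competitive_ratio c d r F (BIB \<Psi> \<gamma> orc sel c d r)"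
    unfolding competitive_ratio_def
    by (rule INF_greatest) (use bound in \<open>auto simp: pos_le_divide_eq\<close>)
  with bound show ?thesis by blast
qed

end
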